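(* Let $\gamma\colon A\otimes B\to C$ be a $1$-generic linear map of finite-dimensional complex vector spaces with $a=\dim A \ge b=\dim B$, and let $X = X_{b-1}\subset\mathbb{P}(C)$ be the associated determinantal variety. Then for every last syzygy $s\in E_{a-b,b}$ of $X$ the syzygy scheme satisfies $\operatorname{supp}\operatorname{Syz}(s)=\operatorname{supp}X$.
   Context: Conventions: points of $\mathbb{P}(C)$ are one-dimensional quotients of $C$, so elements of $C$ are linear forms on $\mathbb{P}(C)$. $\gamma$ is $1$-generic if for every nonzero $\alpha\in A$ the map $B\to C$, $\beta\mapsto\gamma(\alpha\otimes\beta)$, is injective and for every nonzero $\beta\in B$ the map $A\to C$, $\alpha\mapsto\gamma(\alpha\otimes\beta)$, is injective. Choosing bases, $\gamma$ is an $a\times b$ matrix $M$ of linear forms on $\mathbb{P}(C)$; $X=X_{b-1}$ is the subscheme defined by the ideal $I_X$ generated by the $b\times b$ minors of $M$, i.e. the image of the map $\Lambda^bA\otimes\Lambda^bB\to S_bC$, $(a_1\wedge\dots\wedge a_b)\otimes(b_1\wedge\dots\wedge b_b)\mapsto\det(\gamma(a_i\otimes b_j))$; for $1$-generic $\gamma$ this identifies $(I_X)_b=\Lambda^bA\otimes\Lambda^bB$ and $X$ has expected codimension $a-b+1$, with $I_X$ resolved by the Eagon–Northcott complex whose last syzygy space is $E_{a-b,b}=\Lambda^aA\otimes\Lambda^bB\otimes S_{a-b}B$; its elements are called last syzygies of $X$. Let $e_n\colon\Lambda^nA\otimes S_nB\to\Lambda^n(A\otimes B)\to\Lambda^nC$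 be the natural inclusion followed by $\Lambda^n\gamma$ (its image elements are the degree $n$ exterior minors). A last syzygy is viewed as an element of $\Lambda^{a-b}C\otimes(I_X)_b$ via the composition $\Lambda^aA\otimes\Lambda^bB\otimes S_{a-b}B\hookrightarrow\Lambda^bA\otimes\Lambda^bB\otimes\Lambda^{a-b}A\otimes S_{a-b}B\xrightarrow{\mathrm{id}\otimes e_{a-b}}(I_X)_b\otimes\Lambda^{a-b}C$ (first map induced by comultiplication $\Lambda^aA\to\Lambda^bA\otimes\Lambda^{a-b}A$). Writing $s=\sum_\alpha f_\alpha\otimes v_\alpha$ with $(v_\alpha)$ a basis of $\Lambda^{a-b}C$ and $f_\alpha\in(I_X)_b$, the syzygy ideal $I(s)$ is generated by the $f_\alpha$ and the syzygy scheme is $\operatorname{Syz}(s)=V(I(s))\subset\mathbb{P}(C)$.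
   Formalization: The last syzygy s is assumed to be nonzero; for s = 0 the syzygy ideal is zero, so Syz(s) is all of P(C) while X is a proper subset, and the claim fails. *)

theory Defs
  imports Complex_Main "HOL-Combinatorics.Permutations"
begin

text \<open>Coordinates. A = C^a, B = C^b, C = C^c with bases e_i (i<a), f_j (j<b), c_k (k<c).
  The linear map gamma : A (x) B -> C is the tensor g with gamma(e_i (x) f_j) = sum_k g i j k c_k.
  Vectors are functions nat => complex vanishing outside the index range.\<close>

definition vecs :: "nat \<Rightarrow> (nat \<Rightarrow> complex) set" where
  "vecs n = {v. \<forall>i\<ge>n. v i = 0}"

definition gam_left :: "nat \<Rightarrow> nat \<Rightarrow> nat \<Rightarrow> (nat \<Rightarrow> nat \<Rightarrow> nat \<Rightarrow> complex)
    \<Rightarrow> (nat \<Rightarrow> complex) \<Rightarrow> (nat \<Rightarrow> complex) \<Rightarrow> (nat \<Rightarrow> complex)" where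
  "gam_left a b c g \<alpha> \<beta> = (\<lambda>k. if k < c then (\<Sum>i<a. \<Sum>j<b. \<alpha> i * \<beta> j * g i j k) else 0)"

definition one_generic :: "nat \<Rightarrow> nat \<Rightarrow> nat \<Rightarrow> (nat \<Rightarrow> nat \<Rightarrow> nat \<Rightarrow> complex) \<Rightarrow> bool" where
  "one_generic a b c g \<longleftrightarrow>
     (\<forall>\<alpha>\<in>vecs a. \<alpha> \<noteq> (\<lambda>_. 0) \<longrightarrow> inj_on (\<lambda>\<beta>. gam_left a b c g \<alpha> \<beta>) (vecs b)) \<and>
     (\<forall>\<beta>\<in>vecs b. \<beta> \<noteq> (\<lambda>_. 0) \<longrightarrow> inj_on (\<lambda>\<alpha>. gam_left a b c g \<alpha> \<beta>) (vecs a))"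

definition detn :: "nat \<Rightarrow> (nat \<Rightarrow> nat \<Rightarrow> complex) \<Rightarrow> complex" where
  "detn n M = (\<Sum>\<sigma> | \<sigma> permutes {..<n}. of_int (sign \<sigma>) * (\<Prod>t<n. M t (\<sigma> t)))"

text \<open>Value at the point p of P(C) (a nonzero linear functional p on C, p k = p(c_k))
  of the entry M_{ij} = gamma(e_i (x) f_j) of the a x b matrix of linear forms.\<close>
definition matM :: "nat \<Rightarrow> (nat \<Rightarrow> nat \<Rightarrow> nat \<Rightarrow> complex) \<Rightarrow> (nat \<Rightarrow> complex) \<Rightarrow> nat \<Rightarrow> nat \<Rightarrow> complex" where
  "matM c g p i j = (\<Sum>k<c. g i j k * p k)"

definition minor :: "nat \<Rightarrow> nat \<Rightarrow> (nat \<Rightarrow> nat \<Rightarrow> nat \<Rightarrow> complex) \<Rightarrow> nat set \<Rightarrow> (nat \<Rightarrow> complex) \<Rightarrow> complex" where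
  "minor b c g I p = detn b (\<lambda>s t. matM c g p (sorted_list_of_set I ! s) t)"

text \<open>Points of P(C), represented by nonzero coordinate vectors (all sets below are cones).\<close>
definition proj_pts :: "nat \<Rightarrow> (nat \<Rightarrow> complex) set" where
  "proj_pts c = {p\<in>vecs c. p \<noteq> (\<lambda>_. 0)}"

definition supp_X :: "nat \<Rightarrow> nat \<Rightarrow> nat \<Rightarrow> (nat \<Rightarrow> nat \<Rightarrow> nat \<Rightarrow> complex) \<Rightarrow> (nat \<Rightarrow> complex) set" where
  "supp_X a b c g = {p\<in>proj_pts c. \<forall>I. I \<subseteq> {..<a} \<and> card I = b \<longrightarrow> minor b c g I p = 0}"

text \<open>Sign in the comultiplication Lambda^a A -> Lambda^b A (x) Lambda^{a-b} A,
  e_0 ^...^ e_{a-1} |-> sum_I shuffle_sign(I) e_I (x) e_{I^c}.\<close>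
definition shuffle_sign :: "nat \<Rightarrow> nat set \<Rightarrow> complex" where
  "shuffle_sign a I = (-1) ^ card {(i, j). i \<in> I \<and> j \<in> {..<a} - I \<and> j < i}"

definition idx_lists :: "nat \<Rightarrow> nat \<Rightarrow> nat list set" where
  "idx_lists b n = {js. length js = n \<and> set js \<subseteq> {..<b}}"

text \<open>Elements of S_n B (char 0) as symmetric tensors t: coefficient functions on idx_lists b n
  invariant under permutation of positions; t stands for sum_js t js f_{js_0} ... f_{js_{n-1}}.\<close>
definition sym_tensor :: "nat \<Rightarrow> nat \<Rightarrow> (nat list \<Rightarrow> complex) \<Rightarrow> bool" where
  "sym_tensor b n t \<longleftrightarrow> (\<forall>js\<in>idx_lists b n. \<forall>ks\<in>idx_lists b n. mset js = mset ks \<longrightarrow> t js = t ks)"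

text \<open>Coefficient on the basis vector c_K (K sorted) of Lambda^n C of
  e_n((e_{r_0} ^...^ e_{r_{n-1}}) (x) t), where
  e_n : Lambda^n A (x) S_n B -> Lambda^n (A (x) B) -> Lambda^n C,
  (a_1^..^a_n) (x) (b_1...b_n) |-> sum_sigma gamma(a_1 (x) b_sigma1) ^...^ gamma(a_n (x) b_sigma n).\<close>
definition ext_coeff :: "nat \<Rightarrow> nat \<Rightarrow> (nat \<Rightarrow> nat \<Rightarrow> nat \<Rightarrow> complex) \<Rightarrow> nat set \<Rightarrow> (nat list \<Rightarrow> complex)
    \<Rightarrow> nat set \<Rightarrow> complex" where
  "ext_coeff b n g R t K =
     (\<Sum>js\<in>idx_lists b n. t js *
        (\<Sum>\<sigma> | \<sigma> permutes {..<n}.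
           detn n (\<lambda>s u. g (sorted_list_of_set R ! s) (js ! \<sigma> s) (sorted_list_of_set K ! u))))"

text \<open>The component f_K in (I_X)_b (evaluated at p) of the last syzygy
  s = (e_0^..^e_{a-1}) (x) (f_0^..^f_{b-1}) (x) t  in  (I_X)_b (x) Lambda^{a-b} C.\<close>
definition syz_comp :: "nat \<Rightarrow> nat \<Rightarrow> nat \<Rightarrow> (nat \<Rightarrow> nat \<Rightarrow> nat \<Rightarrow> complex) \<Rightarrow> (nat list \<Rightarrow> complex)
    \<Rightarrow> nat set \<Rightarrow> (nat \<Rightarrow> complex) \<Rightarrow> complex" where
  "syz_comp a b c g t K p =
     (\<Sum>I | I \<subseteq> {..<a} \<and> card I = b.
        shuffle_sign a I * minor b c g I p * ext_coeff b (a - b) g ({..<a} - I) t K)"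

definition supp_Syz :: "nat \<Rightarrow> nat \<Rightarrow> nat \<Rightarrow> (nat \<Rightarrow> nat \<Rightarrow> nat \<Rightarrow> complex) \<Rightarrow> (nat list \<Rightarrow> complex)
    \<Rightarrow> (nat \<Rightarrow> complex) set" where
  "supp_Syz a b c g t = {p\<in>proj_pts c. \<forall>K. K \<subseteq> {..<c} \<and> card K = a - b \<longrightarrow> syz_comp a b c g t K p = 0}"

end

theory Submission
  imports Defs "Jordan_Normal_Form.Determinant" "HOL-Computational_Algebra.Fundamental_Theorem_Algebra"
begin

text \<open>
  Let p be a point at which some maximal minor of M does not vanish, let n = a - b, and let U be the
  n-dimensional kernel of the transpose of M(p) in A. By Laplace expansion the value of the syzygy at p
  is, up to a nonzero factor, the exterior minor of a basis of U against t. So the theorem says that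
  the maximal minors of the n rows of linear forms on B given by U span all forms of degree n on B.
  Since the map is 1-generic, these rows are independent at every nonzero point of B.

  This is proved by induction on dim B, after projecting C to the critical dimension n + dim B - 1.
  Split off a hyperplane B' of B and project C once more, from a point outside the image of U x B',
  to C'. By induction the minors restricted to (B', C') form a basis of the forms of degree n on B'.
  Counting linear syzygies, it follows that the forms on B dual to the ideal of the C'-minors carry
  commuting operators "multiplication by a coordinate", and that these preserve the subspace T
  annihilated by all C-minors. If T were nonzero, a common eigenvector would be a pure power of a
  nonzero point of B at which all maximal minors vanish.
\<close>

section \<open>Finite linear systems and common eigenvectors\<close>

text \<open>The point p enters only through U, so the claim becomes one about every n-dimensional
  subspace U of A, and 1-genericity passes to each of them. The critical dimension is the one where
  the forms of degree n on an m-dimensional space and the maximal minors are equally many, (n + m -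
  1 choose n), so that independent minors also span. Geometrically, the induction hypothesis says
  that the C'-minors have no common zero on the hyperplane B'. They therefore cut out a finite
  scheme in an affine chart, and the coordinates act on the dual of its ring. The difficulty is to
  obtain this action without dimension theory or the Cohen-Macaulay property. Here the operators
  live in degree n alone, and they commute because their values are contractions of one tensor of
  degree n + 1. That this tensor exists, and that T is stable, rests on two binomial identities for
  linear syzygies. In the same spirit, the centre of projection is found by counting forms of large
  degree, not by computing the dimension of an image.\<close>

lemma underdetermined_system_nontrivial_solution:
  fixes A :: "'j \<Rightarrow> 'i \<Rightarrow> 'a::field"
  assumes "finite J" "finite I" "card J < card I"
  shows "\<exists>x. (\<exists>i\<in>I. x i \<noteq> 0) \<and> (\<forall>j\<in>J. (\<Sum>i\<in>I. A j i * x i) = 0)"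
  using assms
proof (induction J arbitrary: I A rule: finite_induct)
  case empty
  then have "I \<noteq> {}" by auto
  then show ?case by (intro exI[of _ "\<lambda>_. 1"]) auto
next
  case (insert j0 J)
  show ?case
  proof (cases "\<forall>i\<in>I. A j0 i = 0")
    case True
    have "card J < card I" using insert by simp
    from insert.IH[OF insert.prems(1) this, of A] True show ?thesis
      by (auto simp: sum.neutral)
  next
    case False
    then obtain i0 where i0: "i0 \<in> I" "A j0 i0 \<noteq> 0" by auto
    define A' where "A' j i = A j i - A j i0 / A j0 i0 * A j0 i" for j i
    have "card J < card (I - {i0})" using insert i0 by simp
    from insert.IH[OF _ this, of A'] insert.prems(1) obtain x
      where x: "\<exists>i\<in>I - {i0}. x i \<noteq> 0" "\<And>j. j \<in> J \<Longrightarrow> (\<Sum>i\<in>I - {i0}. A' j i * x i) = 0"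
      by auto
    define s where "s = (\<Sum>i\<in>I - {i0}. A j0 i * x i)"
    define y where "y = x(i0 := - s / A j0 i0)"
    have split: "(\<Sum>i\<in>I. A j i * y i) = A j i0 * (- s / A j0 i0) + (\<Sum>i\<in>I - {i0}. A j i * x i)" for j
      by (subst sum.remove[OF insert.prems(1) i0(1)]) (simp add: y_def)
    have "(\<Sum>i\<in>I. A j i * y i) = 0" if "j \<in> J" for j
      using x(2)[OF that] unfolding split A'_def s_def
      by (simp add: sum_subtractf left_diff_distrib sum_distrib_left sum_divide_distrib mult.assoc)
    moreover have "(\<Sum>i\<in>I. A j0 i * y i) = 0" unfolding split s_def[symmetric] using i0 by simp
    moreover have "\<exists>i\<in>I. y i \<noteq> 0" using x(1) by (auto simp: y_def)
    ultimately show ?thesis by blast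
  qed
qed

text \<open>With -y adjoined as one more column there are more unknowns than equations. In a
  nontrivial solution the extra unknown cannot vanish, by injectivity, and dividing by it solves the
  system.\<close>

lemma injective_square_system_solvable:
  fixes A :: "'j \<Rightarrow> 'i \<Rightarrow> 'a::field"
  assumes fin: "finite J" "finite I" and card: "card J \<le> card I"
    and inj: "\<And>x. (\<And>j. j \<in> J \<Longrightarrow> (\<Sum>i\<in>I. A j i * x i) = 0) \<Longrightarrow> \<forall>i\<in>I. x i = 0"
  shows "\<exists>x. \<forall>j\<in>J. (\<Sum>i\<in>I. A j i * x i) = y j"
proof -
  define A' where "A' j oi = (case oi of None \<Rightarrow> - y j | Some i \<Rightarrow> A j i)" for j oi
  define I' where "I' = insert None (Some ` I)"
  have "card I' = Suc (card I)" unfolding I'_def using fin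
    by (subst card_insert_disjoint) (auto simp: card_image)
  then obtain x where x: "\<exists>i\<in>I'. x i \<noteq> 0" "\<And>j. j \<in> J \<Longrightarrow> (\<Sum>i\<in>I'. A' j i * x i) = 0"
    using underdetermined_system_nontrivial_solution[of J I' A'] fin card by (auto simp: I'_def)
  have eq: "(\<Sum>i\<in>I. A j i * x (Some i)) = y j * x None" if "j \<in> J" for j
  proof -
    have "(\<Sum>i\<in>I'. A' j i * x i) = - y j * x None + (\<Sum>i\<in>I. A j i * x (Some i))"
      unfolding I'_def using fin by (subst sum.insert) (auto simp: A'_def sum.reindex)
    then show ?thesis using x(2)[OF that] by (simp add: eq_neg_iff_add_eq_0)
  qed
  have nz: "x None \<noteq> 0"
  proof
    assume 0: "x None = 0"
    then have "\<forall>i\<in>I. x (Some i) = 0" using inj[of "\<lambda>i. x (Some i)"] eq by simp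
    with x(1) 0 show False by (auto simp: I'_def)
  qed
  have "(\<Sum>i\<in>I. A j i * (x (Some i) / x None)) = y j" if "j \<in> J" for j
    using eq[OF that] nz by (simp add: sum_divide_distrib[symmetric])
  then show ?thesis by (intro exI[of _ "\<lambda>i. x (Some i) / x None"]) auto
qed

text \<open>Exactness of F(H) \<rightarrow> F(I) \<rightarrow> F(J) by a dimension count, where F(S) is the space of functions on S.\<close>

lemma kernel_eq_range_if_card:
  fixes A :: "'j \<Rightarrow> 'i \<Rightarrow> 'a::field" and G :: "'i \<Rightarrow> 'h \<Rightarrow> 'a"
  assumes fin: "finite J" "finite I" "finite H" and card: "card I \<le> card H + card J"
    and surj: "\<And>j0. j0 \<in> J \<Longrightarrow> \<exists>x. \<forall>j\<in>J. (\<Sum>i\<in>I. A j i * x i) = (if j = j0 then 1 else 0)"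
    and inj: "\<And>y. (\<And>i. i \<in> I \<Longrightarrow> (\<Sum>h\<in>H. G i h * y h) = 0) \<Longrightarrow> \<forall>h\<in>H. y h = 0"
    and comp: "\<And>j h. j \<in> J \<Longrightarrow> h \<in> H \<Longrightarrow> (\<Sum>i\<in>I. A j i * G i h) = 0"
    and ker: "\<And>j. j \<in> J \<Longrightarrow> (\<Sum>i\<in>I. A j i * x i) = 0"
  shows "\<exists>y. \<forall>i\<in>I. x i = (\<Sum>h\<in>H. G i h * y h)"
proof -
  from surj obtain R where R: "\<And>j0 j. j0 \<in> J \<Longrightarrow> j \<in> J \<Longrightarrow> (\<Sum>i\<in>I. A j i * R j0 i) = (if j = j0 then 1 else 0)"
    by metis
  \<comment> \<open>The columns of G together with a right inverse R of A. This map is injective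
    because A kills G and A R = 1, hence onto by the count. Applying A to a preimage of x reads off
    its J-part, which is zero when A x = 0.\<close>
  define S where "S i s = (case s of Inl h \<Rightarrow> G i h | Inr j \<Rightarrow> R j i)" for i s
  have sumS: "(\<Sum>s\<in>H <+> J. S i s * z s) = (\<Sum>h\<in>H. G i h * z (Inl h)) + (\<Sum>j\<in>J. R j i * z (Inr j))" for i z
    using fin by (simp add: sum.Plus S_def)
  have AS: "(\<Sum>i\<in>I. A j i * (\<Sum>s\<in>H <+> J. S i s * z s)) = z (Inr j)" if "j \<in> J" for j z
  proof -
    have "(\<Sum>i\<in>I. A j i * (\<Sum>s\<in>H <+> J. S i s * z s)) =
        (\<Sum>i\<in>I. \<Sum>h\<in>H. A j i * G i h * z (Inl h)) + (\<Sum>i\<in>I. \<Sum>j'\<in>J. A j i * R j' i * z (Inr j'))"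
      unfolding sumS by (simp add: distrib_left sum.distrib sum_distrib_left mult.assoc)
    also have "(\<Sum>i\<in>I. \<Sum>h\<in>H. A j i * G i h * z (Inl h)) = (\<Sum>h\<in>H. (\<Sum>i\<in>I. A j i * G i h) * z (Inl h))"
      by (subst sum.swap) (simp add: sum_distrib_right)
    also have "\<dots> = 0" using comp[OF that] by simp
    also have "(\<Sum>i\<in>I. \<Sum>j'\<in>J. A j i * R j' i * z (Inr j')) = (\<Sum>j'\<in>J. (\<Sum>i\<in>I. A j i * R j' i) * z (Inr j'))"
      by (subst sum.swap) (simp add: sum_distrib_right)
    also have "\<dots> = (\<Sum>j'\<in>J. (if j = j' then 1 else 0) * z (Inr j'))"
      using R that by (intro sum.cong) auto
    also have "\<dots> = z (Inr j)" using that fin by (simp add: if_distrib[of "\<lambda>u. u * _"] cong: if_cong)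
    finally show ?thesis by simp
  qed
  have "\<exists>z. \<forall>i\<in>I. (\<Sum>s\<in>H <+> J. S i s * z s) = x i"
  proof (rule injective_square_system_solvable)
    show "card I \<le> card (H <+> J)" using card fin by (simp add: card_Plus)
    fix z assume z: "\<And>i. i \<in> I \<Longrightarrow> (\<Sum>s\<in>H <+> J. S i s * z s) = 0"
    have 1: "z (Inr j) = 0" if "j \<in> J" for j using AS[OF that, of z] z by simp
    have "\<forall>h\<in>H. z (Inl h) = 0" using z 1 unfolding sumS by (intro inj) simp
    with 1 show "\<forall>s\<in>H <+> J. z s = 0" by auto
  qed (use fin in auto)
  then obtain z where z: "\<And>i. i \<in> I \<Longrightarrow> (\<Sum>s\<in>H <+> J. S i s * z s) = x i" by auto
  have "z (Inr j) = 0" if "j \<in> J" for j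
    using AS[OF that, of z] ker[OF that] z by simp
  then have "x i = (\<Sum>h\<in>H. G i h * z (Inl h))" if "i \<in> I" for i
    using z[OF that] unfolding sumS by simp
  then show ?thesis by (intro exI[of _ "\<lambda>h. z (Inl h)"]) auto
qed

section \<open>Linear operators on function spaces and their eigenvectors\<close>

definition lin_subspace :: "('i \<Rightarrow> complex) set \<Rightarrow> bool" where
  "lin_subspace V \<longleftrightarrow> (\<lambda>_. 0) \<in> V \<and> (\<forall>v\<in>V. \<forall>w\<in>V. \<forall>a b. (\<lambda>i. a * v i + b * w i) \<in> V)"

definition lin_op :: "('i \<Rightarrow> complex) set \<Rightarrow> (('i \<Rightarrow> complex) \<Rightarrow> 'i \<Rightarrow> complex) \<Rightarrow> bool" where
  "lin_op V F \<longleftrightarrow> (\<forall>v\<in>V. F v \<in> V) \<and>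
     (\<forall>v\<in>V. \<forall>w\<in>V. \<forall>a b. F (\<lambda>i. a * v i + b * w i) = (\<lambda>i. a * F v i + b * F w i))"

lemma lin_subspaceD:
  "lin_subspace V \<Longrightarrow> v \<in> V \<Longrightarrow> w \<in> V \<Longrightarrow> (\<lambda>i. a * v i + b * w i) \<in> V"
  by (simp add: lin_subspace_def)

lemma lin_opD:
  "lin_op V F \<Longrightarrow> v \<in> V \<Longrightarrow> w \<in> V \<Longrightarrow> F (\<lambda>i. a * v i + b * w i) = (\<lambda>i. a * F v i + b * F w i)"
  by (simp add: lin_op_def)

lemma lin_subspace_sum:
  assumes "lin_subspace V" "finite S" "\<And>s. s \<in> S \<Longrightarrow> f s \<in> V"
  shows "(\<lambda>i. \<Sum>s\<in>S. a s * f s i) \<in> V"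
  using assms(2,3)
proof (induction S rule: finite_induct)
  case empty
  then show ?case using assms(1) by (simp add: lin_subspace_def)
next
  case (insert x S)
  then have "f x \<in> V" "(\<lambda>i. \<Sum>s\<in>S. a s * f s i) \<in> V" by auto
  with assms(1) have "(\<lambda>i. a x * f x i + 1 * (\<Sum>s\<in>S. a s * f s i)) \<in> V"
    by (rule lin_subspaceD)
  then show ?case using insert by simp
qed

lemma lin_op_sum:
  assumes "lin_subspace V" "lin_op V F" "finite S" "\<And>s. s \<in> S \<Longrightarrow> f s \<in> V"
  shows "F (\<lambda>i. \<Sum>s\<in>S. a s * f s i) = (\<lambda>i. \<Sum>s\<in>S. a s * F (f s) i)"
  using assms(3,4)
proof (induction S rule: finite_induct)
  case empty
  have "(\<lambda>_. 0) \<in> V" using assms(1) by (simp add: lin_subspace_def)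
  from lin_opD[OF assms(2) this this, of 0 0] show ?case by simp
next
  case (insert x S)
  have "f x \<in> V" "(\<lambda>i. \<Sum>s\<in>S. a s * f s i) \<in> V"
    using insert lin_subspace_sum[OF assms(1), of S f a] by auto
  then have "F (\<lambda>i. a x * f x i + 1 * (\<Sum>s\<in>S. a s * f s i)) =
      (\<lambda>i. a x * F (f x) i + 1 * F (\<lambda>i. \<Sum>s\<in>S. a s * f s i) i)"
    by (rule lin_opD[OF assms(2)])
  then show ?case using insert by simp
qed

text \<open>Split off a root: p = (X - z) q. Then w = q(F) v is either zero, and q has smaller
  degree, or an eigenvector for z, since (F - z) w = p(F) v = 0.\<close>

lemma lin_op_eigenvector_if_poly_annihilates:
  assumes V: "lin_subspace V" "lin_op V F"
    and p: "p \<noteq> 0" "v \<in> V" "v \<noteq> (\<lambda>_. 0)" "(\<lambda>i. \<Sum>k\<le>degree p. coeff p k * (F ^^ k) v i) = (\<lambda>_. 0)"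
  shows "\<exists>w\<in>V. w \<noteq> (\<lambda>_. 0) \<and> (\<exists>z. F w = (\<lambda>i. z * w i))"
  using p
proof (induction "degree p" arbitrary: p)
  case 0
  then obtain a where "p = [:a:]" by (metis degree_eq_zeroE)
  then show ?case using 0 by (auto simp: fun_eq_iff)
next
  case (Suc d)
  have iter: "(F ^^ k) v \<in> V" for k
    using V(2) Suc.prems(2) by (induction k) (auto simp: lin_op_def)
  have "\<not> constant (poly p)" using Suc by (simp add: constant_degree)
  then obtain z where "poly p z = 0" using fundamental_theorem_of_algebra by blast
  then obtain q where q: "p = [:- z, 1:] * q" using poly_eq_0_iff_dvd by (metis dvdE)
  have q0: "q \<noteq> 0" using q Suc.prems by auto
  have "degree p = degree [:- z, 1:] + degree q" unfolding q by (rule degree_mult_eq) (use q0 in auto)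
  then have dq: "degree q = d" using Suc.hyps(2) by simp
  define w where "w = (\<lambda>i. \<Sum>k\<le>d. coeff q k * (F ^^ k) v i)"
  show ?case
  proof (cases "w = (\<lambda>_. 0)")
    case True
    then show ?thesis using Suc.hyps(1)[of q] dq q0 Suc.prems by (simp add: w_def)
  next
    case False
    have wV: "w \<in> V" unfolding w_def by (rule lin_subspace_sum[OF V(1)]) (auto intro: iter)
    have Fw: "F w = (\<lambda>i. \<Sum>k\<le>d. coeff q k * (F ^^ Suc k) v i)"
      unfolding w_def by (subst lin_op_sum[OF V]) (auto intro: iter)
    have "F w i - z * w i = 0" for i
    proof -
      have c: "coeff p k = (if k = 0 then 0 else coeff q (k - 1)) - z * coeff q k" for k
        unfolding q by (cases k) (auto simp: coeff_pCons)
      have "0 = (\<Sum>k\<le>Suc d. coeff p k * (F ^^ k) v i)"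
        using fun_cong[OF Suc.prems(4), of i] Suc.hyps(2) by simp
      also have "\<dots> = (\<Sum>k\<le>Suc d. (if k = 0 then 0 else coeff q (k - 1)) * (F ^^ k) v i)
           - (\<Sum>k\<le>Suc d. z * coeff q k * (F ^^ k) v i)"
        unfolding c by (simp add: left_diff_distrib sum_subtractf)
      also have "(\<Sum>k\<le>Suc d. (if k = 0 then 0 else coeff q (k - 1)) * (F ^^ k) v i) = F w i"
        unfolding Fw by (subst sum.atMost_Suc_shift) simp
      also have "(\<Sum>k\<le>Suc d. z * coeff q k * (F ^^ k) v i) = z * w i"
        unfolding w_def using dq by (simp add: coeff_eq_0 sum_distrib_left mult.assoc)
      finally show ?thesis by simp
    qed
    then show ?thesis using wV False by (intro bexI[of _ w]) auto
  qed
qed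

text \<open>The card I + 1 iterates v, F v, F^2 v, ... live on the finite set I, so they are
  dependent; the dependence is a nonzero polynomial in F that kills v.\<close>

lemma lin_op_has_eigenvector:
  assumes V: "lin_subspace V" "lin_op V F" and fin: "finite I"
    and supp: "\<And>v i. v \<in> V \<Longrightarrow> i \<notin> I \<Longrightarrow> v i = 0"
    and v: "v \<in> V" "v \<noteq> (\<lambda>_. 0)"
  shows "\<exists>w\<in>V. w \<noteq> (\<lambda>_. 0) \<and> (\<exists>z. F w = (\<lambda>i. z * w i))"
proof -
  have iter: "(F ^^ k) v \<in> V" for k
    using V(2) v(1) by (induction k) (auto simp: lin_op_def)
  obtain x where x: "\<exists>k\<in>{..card I}. x k \<noteq> 0" "\<And>i. i \<in> I \<Longrightarrow> (\<Sum>k\<le>card I. (F ^^ k) v i * x k) = 0"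
    using underdetermined_system_nontrivial_solution[of I "{..card I}" "\<lambda>i k. (F ^^ k) v i"] fin by auto
  define p where "p = (\<Sum>k\<le>card I. monom (x k) k)"
  have cp: "coeff p k = (if k \<le> card I then x k else 0)" for k
    unfolding p_def by (simp add: coeff_sum sum.delta)
  have "p \<noteq> 0" using x(1) cp by (metis atMost_iff coeff_0)
  moreover have "(\<Sum>k\<le>degree p. coeff p k * (F ^^ k) v i) = 0" for i
  proof -
    have "degree p \<le> card I" by (rule degree_le) (simp add: cp)
    then have "(\<Sum>k\<le>degree p. coeff p k * (F ^^ k) v i) = (\<Sum>k\<le>card I. coeff p k * (F ^^ k) v i)"
      by (intro sum.mono_neutral_left) (auto simp: coeff_eq_0)
    also have "\<dots> = 0" using x(2)[of i] supp[OF iter, of i] by (cases "i \<in> I") (auto simp: cp mult.commute)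
    finally show ?thesis .
  qed
  ultimately show ?thesis using lin_op_eigenvector_if_poly_annihilates[OF V] v by auto
qed

text \<open>A nonzero joint eigenspace of the first k operators is stable under the next one,
  because the operators commute, and so it contains an eigenvector of that one.\<close>

lemma commuting_lin_ops_common_eigenvector:
  fixes F :: "nat \<Rightarrow> ('i \<Rightarrow> complex) \<Rightarrow> 'i \<Rightarrow> complex"
  assumes V: "lin_subspace V" "\<And>j. j < n \<Longrightarrow> lin_op V (F j)" and fin: "finite I"
    and supp: "\<And>v i. v \<in> V \<Longrightarrow> i \<notin> I \<Longrightarrow> v i = 0"
    and v: "v \<in> V" "v \<noteq> (\<lambda>_. 0)"
    and comm: "\<And>i j v. i < n \<Longrightarrow> j < n \<Longrightarrow> v \<in> V \<Longrightarrow> F i (F j v) = F j (F i v)"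
  shows "\<exists>w\<in>V. w \<noteq> (\<lambda>_. 0) \<and> (\<exists>z. \<forall>j<n. F j w = (\<lambda>i. z j * w i))"
proof -
  have "\<exists>w\<in>V. w \<noteq> (\<lambda>_. 0) \<and> (\<exists>z. \<forall>j<k. F j w = (\<lambda>i. z j * w i))" if "k \<le> n" for k
    using that
  proof (induction k)
    case 0
    then show ?case using v by auto
  next
    case (Suc k)
    then obtain w z where w: "w \<in> V" "w \<noteq> (\<lambda>_. 0)" "\<And>j. j < k \<Longrightarrow> F j w = (\<lambda>i. z j * w i)"
      by fastforce
    define V' where "V' = {u\<in>V. \<forall>j<k. F j u = (\<lambda>i. z j * u i)}"
    have Fl: "F j (\<lambda>i. a * u i + b * u' i) = (\<lambda>i. a * F j u i + b * F j u' i)"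
      if "j \<le> k" "u \<in> V" "u' \<in> V" for j a b u u'
      using V(2)[of j] that Suc.prems unfolding lin_op_def by auto
    have F0: "F j (\<lambda>_. 0) = (\<lambda>_. 0)" if "j \<le> k" for j
      using Fl[OF that w(1) w(1), of 0 0] by simp
    have sub: "lin_subspace V'"
      unfolding lin_subspace_def
    proof (intro conjI ballI allI)
      show "(\<lambda>_. 0) \<in> V'" using V(1) F0 by (simp add: V'_def lin_subspace_def)
      fix u u' a b assume u: "u \<in> V'" "u' \<in> V'"
      then have "u \<in> V" "u' \<in> V" by (auto simp: V'_def)
      moreover from this have "(\<lambda>i. a * u i + b * u' i) \<in> V" using lin_subspaceD[OF V(1)] by auto
      ultimately show "(\<lambda>i. a * u i + b * u' i) \<in> V'" using Fl u
        by (auto simp: V'_def fun_eq_iff algebra_simps)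
    qed
    have op: "lin_op V' (F k)"
      unfolding lin_op_def
    proof (intro conjI ballI allI)
      fix u assume u: "u \<in> V'"
      have uV: "u \<in> V" using u by (simp add: V'_def)
      have "F j (F k u) = (\<lambda>i. z j * F k u i)" if "j < k" for j
      proof -
        have "F j (F k u) = F k (F j u)" using comm[of j k u] that Suc.prems uV by simp
        also have "F j u = (\<lambda>i. z j * u i + 0 * u i)" using u that by (simp add: V'_def)
        also have "F k \<dots> = (\<lambda>i. z j * F k u i + 0 * F k u i)" by (rule Fl) (use uV in auto)
        finally show ?thesis by simp
      qed
      moreover have "F k u \<in> V" using V(2)[of k] Suc.prems uV by (simp add: lin_op_def)
      ultimately show "F k u \<in> V'" by (simp add: V'_def)
    next
      fix u u' a b assume "u \<in> V'" "u' \<in> V'"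
      then show "F k (\<lambda>i. a * u i + b * u' i) = (\<lambda>i. a * F k u i + b * F k u' i)"
        using Fl[of k u u' a b] by (auto simp: V'_def)
    qed
    have "w \<in> V'" using w by (simp add: V'_def)
    then obtain u y where u: "u \<in> V'" "u \<noteq> (\<lambda>_. 0)" "F k u = (\<lambda>i. y * u i)"
      using lin_op_has_eigenvector[OF sub op fin, of w] w(2) supp by (auto simp: V'_def)
    show ?case
      by (rule bexI[of _ u]) (use u in \<open>auto simp: V'_def less_Suc_eq intro!: exI[of _ "z(k := y)"]\<close>)
  qed
  then show ?thesis by blast
qed

section \<open>Exterior products and exterior minors\<close>

abbreviation subsets_of_card :: "nat \<Rightarrow> nat \<Rightarrow> nat set set" where
  "subsets_of_card c n \<equiv> {K. K \<subseteq> {..<c} \<and> card K = n}"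

abbreviation msets :: "nat \<Rightarrow> nat \<Rightarrow> nat multiset set" where
  "msets b n \<equiv> multisets_of_size {..<b} n"

lemma finite_subsets_of_card [simp]: "finite (subsets_of_card c n)"
  by (rule finite_subset[of _ "Pow {..<c}"]) auto

lemma add_mset_in_msets_iff [simp]: "add_mset j M \<in> msets b (Suc n) \<longleftrightarrow> j < b \<and> M \<in> msets b n"
  by (auto simp: multisets_of_size_def)

text \<open>For k in K this is the sign in e_k ^ e_(K - {k}) = \<open>pos_sign k K\<close>
  e_K.\<close>

definition pos_sign :: "nat \<Rightarrow> nat set \<Rightarrow> complex" where
  "pos_sign k K = (- 1) ^ card {i\<in>K. i < k}"

text \<open>An element of the exterior power of degree n is stored as its coefficient function on the
  n-element index sets; this is left multiplication by the vector x.\<close>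

definition wedge :: "(nat \<Rightarrow> complex) \<Rightarrow> (nat set \<Rightarrow> complex) \<Rightarrow> nat set \<Rightarrow> complex" where
  "wedge x z K = (\<Sum>k\<in>K. pos_sign k K * x k * z (K - {k}))"

lemma pos_sign_remove:
  assumes "finite K" "k \<in> K"
  shows "k < k' \<Longrightarrow> pos_sign k' K = - pos_sign k' (K - {k})" "k' \<le> k \<Longrightarrow> pos_sign k' (K - {k}) = pos_sign k' K"
proof -
  assume "k < k'"
  then have "{i\<in>K. i < k'} = insert k {i\<in>K - {k}. i < k'}" using assms by auto
  then show "pos_sign k' K = - pos_sign k' (K - {k})" unfolding pos_sign_def using assms by simp
next
  assume "k' \<le> k"
  then have "{i\<in>K - {k}. i < k'} = {i\<in>K. i < k'}" by auto
  then show "pos_sign k' (K - {k}) = pos_sign k' K" unfolding pos_sign_def by simp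
qed

text \<open>Of the two elements only the larger one has the other below it, so its sign alone
  changes when the other is removed.\<close>

lemma pos_sign_swap:
  assumes "finite K" "k \<in> K" "k' \<in> K" "k \<noteq> k'"
  shows "pos_sign k K * pos_sign k' (K - {k}) = - (pos_sign k' K * pos_sign k (K - {k'}))"
proof (cases "k < k'")
  case True
  have "pos_sign k' K = - pos_sign k' (K - {k})" "pos_sign k (K - {k'}) = pos_sign k K"
    using pos_sign_remove(1)[of K k k'] pos_sign_remove(2)[of K k' k] assms True by auto
  then show ?thesis by simp
next
  case False
  have "pos_sign k K = - pos_sign k (K - {k'})" "pos_sign k' (K - {k}) = pos_sign k' K"
    using pos_sign_remove(1)[of K k' k] pos_sign_remove(2)[of K k k'] assms False by auto
  then show ?thesis by simp
qed

lemma sum_distinct_pairs_swap: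
  assumes "finite K"
  shows "(\<Sum>k\<in>K. \<Sum>k'\<in>K - {k}. h k k') = (\<Sum>k\<in>K. \<Sum>k'\<in>K - {k}. (h k' k :: complex))"
proof -
  have *: "(\<Sum>k\<in>K. \<Sum>k'\<in>K - {k}. h k k') = (\<Sum>k\<in>K. \<Sum>k'\<in>K. if k = k' then 0 else h k k')" for h :: "'a \<Rightarrow> 'a \<Rightarrow> complex"
    by (rule sum.cong[OF refl], rule sum.mono_neutral_cong_left[OF assms]) auto
  have "(\<Sum>k\<in>K. \<Sum>k'\<in>K - {k}. h k k') = (\<Sum>k'\<in>K. \<Sum>k\<in>K. if k = k' then 0 else h k k')"
    using *[of h] sum.swap by (rule trans)
  also have "\<dots> = (\<Sum>k\<in>K. \<Sum>k'\<in>K - {k}. h k' k)"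
    unfolding *[of "\<lambda>k k'. h k' k"] by (intro sum.cong refl) auto
  finally show ?thesis .
qed

lemma wedge_anticommute:
  assumes "finite K"
  shows "wedge x (wedge y z) K = - wedge y (wedge x z) K"
proof -
  have "wedge x (wedge y z) K =
      (\<Sum>k\<in>K. \<Sum>k'\<in>K - {k}. (pos_sign k K * pos_sign k' (K - {k})) * x k * y k' * z (K - {k} - {k'}))"
    unfolding wedge_def by (simp add: sum_distrib_left mult_ac)
  also have "\<dots> = (\<Sum>k\<in>K. \<Sum>k'\<in>K - {k}. (pos_sign k' K * pos_sign k (K - {k'})) * x k' * y k * z (K - {k'} - {k}))"
    by (rule sum_distinct_pairs_swap[OF assms])
  also have "\<dots> = (\<Sum>k\<in>K. \<Sum>k'\<in>K - {k}. - ((pos_sign k K * pos_sign k' (K - {k})) * y k * x k' * z (K - {k} - {k'})))"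
  proof (intro sum.cong refl)
    fix k k' assume k: "k \<in> K" "k' \<in> K - {k}"
    have "K - {k'} - {k} = K - {k} - {k'}" by auto
    then show "pos_sign k' K * pos_sign k (K - {k'}) * x k' * y k * z (K - {k'} - {k}) =
        - (pos_sign k K * pos_sign k' (K - {k}) * y k * x k' * z (K - {k} - {k'}))"
      using pos_sign_swap[of K k' k] assms k by auto
  qed
  also have "\<dots> = - wedge y (wedge x z) K"
    unfolding wedge_def by (simp add: sum_distrib_left sum_negf mult_ac)
  finally show ?thesis .
qed

lemma wedge_cong:
  assumes "\<And>k. k \<in> K \<Longrightarrow> z (K - {k}) = z' (K - {k})"
  shows "wedge x z K = wedge x z' K"
  unfolding wedge_def using assms by (intro sum.cong) auto

lemma wedge_zero [simp]: "wedge x (\<lambda>_. 0) K = 0"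
  by (simp add: wedge_def)

lemma wedge_lin: "wedge x (\<lambda>L. a * z L + b * z' L) K = a * wedge x z K + b * wedge x z' K"
  unfolding wedge_def by (simp add: sum.distrib sum_distrib_left algebra_simps)

lemma wedge_sum: "wedge x (\<lambda>L. \<Sum>s\<in>S. f s L) K = (\<Sum>s\<in>S. wedge x (f s) K)"
  unfolding wedge_def by (subst sum.swap) (simp add: sum_distrib_left)

lemma wedge_scale: "wedge x (\<lambda>L. a * z L) K = a * wedge x z K"
  unfolding wedge_def by (simp add: sum_distrib_left algebra_simps)

lemma wedge_sum_left: "wedge (\<lambda>k. \<Sum>s\<in>S. a s * f s k) z K = (\<Sum>s\<in>S. a s * wedge (f s) z K)"
proof -
  have "wedge (\<lambda>k. \<Sum>s\<in>S. a s * f s k) z K = (\<Sum>k\<in>K. \<Sum>s\<in>S. a s * (pos_sign k K * f s k * z (K - {k})))"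
    unfolding wedge_def sum_distrib_left sum_distrib_right by (intro sum.cong refl) (simp only: mult_ac)
  also have "\<dots> = (\<Sum>s\<in>S. a s * wedge (f s) z K)"
    unfolding wedge_def sum_distrib_left by (rule sum.swap)
  finally show ?thesis .
qed

text \<open>For fixed x this exhibits \<open>wedge x\<close> as a matrix indexed by subsets, the
  form to which \<open>kernel_eq_range_if_card\<close> applies.\<close>

lemma wedge_basis_expand:
  assumes "K \<in> subsets_of_card c (Suc n)"
  shows "wedge x z K = (\<Sum>L\<in>subsets_of_card c n. z L * wedge x (\<lambda>K'. if K' = L then 1 else 0) K)"
proof -
  have "wedge x z K = wedge x (\<lambda>K'. \<Sum>L\<in>subsets_of_card c n. z L * (if K' = L then 1 else 0)) K"
  proof (rule wedge_cong)
    fix k assume "k \<in> K"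
    then have "K - {k} \<in> subsets_of_card c n" using assms by (auto simp: card_Diff_singleton)
    then show "z (K - {k}) = (\<Sum>L\<in>subsets_of_card c n. z L * (if K - {k} = L then 1 else 0))"
      by (simp add: if_distrib[of "\<lambda>u. _ * u"] sum.delta' cong: if_cong)
  qed
  then show ?thesis by (simp add: wedge_sum wedge_scale)
qed

text \<open>A symmetric tensor is stored as a function \<open>\<tau>\<close> of multisets of indices. For \<open>ls = [0..<n]\<close> this
  is the exterior minor of the rows \<open>ls\<close> of the matrix of vectors \<open>g l j\<close> belonging to \<open>\<tau>\<close>.\<close>

primrec exterior_minor :: "nat \<Rightarrow> (nat \<Rightarrow> nat \<Rightarrow> nat \<Rightarrow> complex) \<Rightarrow> nat list \<Rightarrow> (nat multiset \<Rightarrow> complex)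
    \<Rightarrow> nat set \<Rightarrow> complex" where
  "exterior_minor b g [] \<tau> K = \<tau> {#}"
| "exterior_minor b g (l # ls) \<tau> K =
     (\<Sum>j<b. wedge (g l j) (exterior_minor b g ls (\<lambda>M. \<tau> (add_mset j M))) K)"

lemma exterior_minor_Cons:
  "exterior_minor b g (l # ls) \<tau> =
     (\<lambda>K. \<Sum>j<b. wedge (g l j) (exterior_minor b g ls (\<lambda>M. \<tau> (add_mset j M))) K)"
  by (rule ext) simp

lemma exterior_minor_cong:
  assumes "\<And>M. M \<in> msets b (length ls) \<Longrightarrow> \<tau> M = \<tau>' M"
  shows "exterior_minor b g ls \<tau> K = exterior_minor b g ls \<tau>' K"
  using assms
proof (induction ls arbitrary: \<tau> \<tau>' K)
  case Nil
  then show ?case by simp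
next
  case (Cons l ls)
  show ?case unfolding exterior_minor.simps
    by (intro sum.cong refl wedge_cong Cons.IH Cons.prems) auto
qed

lemma exterior_minor_lin:
  "exterior_minor b g ls (\<lambda>M. x * \<tau> M + y * \<tau>' M) K =
     x * exterior_minor b g ls \<tau> K + y * exterior_minor b g ls \<tau>' K"
proof (induction ls arbitrary: \<tau> \<tau>' K)
  case (Cons l ls)
  have "exterior_minor b g ls (\<lambda>M. x * \<tau> M + y * \<tau>' M) =
      (\<lambda>L. x * exterior_minor b g ls \<tau> L + y * exterior_minor b g ls \<tau>' L)" for \<tau> \<tau>'
    using Cons.IH by (intro ext)
  then show ?case by (simp add: wedge_lin sum.distrib sum_distrib_left)
qed simp

lemma exterior_minor_zero: "exterior_minor b g ls (\<lambda>M. 0) K = 0"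
  using exterior_minor_lin[of b g ls 0 _ 0] by simp

lemma exterior_minor_scale: "exterior_minor b g ls (\<lambda>M. x * \<tau> M) K = x * exterior_minor b g ls \<tau> K"
  using exterior_minor_lin[of b g ls x \<tau> 0] by simp

lemma exterior_minor_add:
  "exterior_minor b g ls (\<lambda>M. \<tau> M + \<tau>' M) K = exterior_minor b g ls \<tau> K + exterior_minor b g ls \<tau>' K"
  using exterior_minor_lin[of b g ls 1 \<tau> 1] by simp

lemma exterior_minor_sum:
  assumes "finite S"
  shows "exterior_minor b g ls (\<lambda>M. \<Sum>s\<in>S. x s * f s M) K = (\<Sum>s\<in>S. x s * exterior_minor b g ls (f s) K)"
  using assms
  by (induction S rule: finite_induct) (simp_all add: exterior_minor_zero exterior_minor_add exterior_minor_scale)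

lemma exterior_minor_basis_expand:
  "exterior_minor b g ls \<tau> K =
     (\<Sum>M\<in>msets b (length ls). \<tau> M * exterior_minor b g ls (\<lambda>N. if N = M then 1 else 0) K)"
proof -
  have fin: "finite (msets b (length ls))" by (simp add: finite_multisets_of_size)
  have "exterior_minor b g ls \<tau> K =
      exterior_minor b g ls (\<lambda>N. \<Sum>M\<in>msets b (length ls). \<tau> M * (if N = M then 1 else 0)) K"
    by (rule exterior_minor_cong) (use fin in \<open>simp add: if_distrib[of "\<lambda>u. _ * u"] sum.delta' cong: if_cong\<close>)
  then show ?thesis using fin by (simp add: exterior_minor_sum)
qed

text \<open>The argument of \<tau> is a multiset, so exchanging two rows only exchanges two vectors
  in a wedge product.\<close>

lemma exterior_minor_swap:
  assumes "finite K"
  shows "exterior_minor b g (l # l' # ls) \<tau> K = - exterior_minor b g (l' # l # ls) \<tau> K"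
proof -
  let ?e = "\<lambda>j i. exterior_minor b g ls (\<lambda>M. \<tau> (add_mset j (add_mset i M)))"
  have "exterior_minor b g (l # l' # ls) \<tau> K = (\<Sum>j<b. \<Sum>i<b. wedge (g l j) (wedge (g l' i) (?e j i)) K)"
    by (simp add: exterior_minor_Cons wedge_sum)
  also have "\<dots> = (\<Sum>i<b. \<Sum>j<b. - wedge (g l' i) (wedge (g l j) (?e i j)) K)"
    by (subst sum.swap, intro sum.cong refl, subst wedge_anticommute[OF assms]) (simp add: add_mset_commute)
  also have "\<dots> = - exterior_minor b g (l' # l # ls) \<tau> K"
    by (simp add: exterior_minor_Cons wedge_sum sum_negf)
  finally show ?thesis .
qed

text \<open>The linear relations used below come from here: for l < n the row list
  \<open>l # [0..<n]\<close> repeats l, and expanding along its first entry gives a relation with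
  the vectors g l j as coefficients.\<close>

lemma exterior_minor_repeated_row:
  assumes "finite K" "l \<in> set ls"
  shows "exterior_minor b g (l # ls) \<tau> K = 0"
  using assms
proof (induction ls arbitrary: \<tau> K)
  case (Cons l' ls)
  show ?case
  proof (cases "l = l'")
    case True
    then show ?thesis using exterior_minor_swap[OF Cons.prems(1), of b g l l ls \<tau>] by simp
  next
    case False
    then have "exterior_minor b g (l # ls) (\<lambda>M. \<tau> (add_mset j M)) (K - {k}) = 0" for j k
      using Cons.IH[of "K - {k}"] Cons.prems by simp
    then have "exterior_minor b g (l' # l # ls) \<tau> K = 0"
      unfolding exterior_minor.simps(2)[of b g l'] by (simp add: wedge_def)
    then show ?thesis using exterior_minor_swap[OF Cons.prems(1), of b g l l' ls \<tau>] by simp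
  qed
qed simp

lemma exterior_minor_move_to_front:
  assumes "finite K"
  shows "exterior_minor b g (xs @ l # ys) \<tau> K = (- 1) ^ length xs * exterior_minor b g (l # xs @ ys) \<tau> K"
  using assms
proof (induction xs arbitrary: \<tau> K)
  case (Cons x xs)
  have "exterior_minor b g ((x # xs) @ l # ys) \<tau> K =
      (\<Sum>j<b. wedge (g x j) (\<lambda>L. (- 1) ^ length xs * exterior_minor b g (l # xs @ ys) (\<lambda>M. \<tau> (add_mset j M)) L) K)"
    unfolding append_Cons exterior_minor.simps(2)[of b g x]
    by (intro sum.cong refl wedge_cong) (simp add: Cons del: exterior_minor.simps)
  also have "\<dots> = (- 1) ^ length xs * exterior_minor b g (x # l # xs @ ys) \<tau> K"
    unfolding exterior_minor.simps(2)[of b g x] wedge_scale by (simp only: sum_distrib_left)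
  also have "\<dots> = (- 1) ^ length (x # xs) * exterior_minor b g (l # (x # xs) @ ys) \<tau> K"
    using exterior_minor_swap[OF Cons.prems, of b g x l "xs @ ys" \<tau>] by simp
  finally show ?case .
qed simp

text \<open>A tensor without the index m cannot see the last column; this compares minors on B =
  C^(m+1) with minors on the hyperplane B' = C^m.\<close>

lemma exterior_minor_restrict:
  assumes "\<And>M. M \<in> msets (Suc m) (length ls) \<Longrightarrow> m \<in># M \<Longrightarrow> \<tau> M = 0"
  shows "exterior_minor (Suc m) g ls \<tau> K = exterior_minor m g ls \<tau> K"
  using assms
proof (induction ls arbitrary: \<tau> K)
  case (Cons l ls)
  have "exterior_minor (Suc m) g ls (\<lambda>M. \<tau> (add_mset m M)) L = exterior_minor (Suc m) g ls (\<lambda>M. 0) L" for L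
    by (rule exterior_minor_cong) (use Cons.prems in auto)
  then have "wedge (g l m) (exterior_minor (Suc m) g ls (\<lambda>M. \<tau> (add_mset m M))) K = 0"
    by (simp add: exterior_minor_zero wedge_def)
  moreover have "wedge (g l j) (exterior_minor (Suc m) g ls (\<lambda>M. \<tau> (add_mset j M))) K =
      wedge (g l j) (exterior_minor m g ls (\<lambda>M. \<tau> (add_mset j M))) K" if "j < m" for j
    by (intro wedge_cong Cons.IH Cons.prems) (use that in auto)
  ultimately show ?case by simp
qed simp

section \<open>Linear syzygies of independent exterior minors\<close>

lemma times_binomial_Suc: "Suc k * (N choose Suc k) = (N - k) * (N choose k)"
  by (metis binomial_absorption binomial_absorb_comp)

lemma minus_one_power_self_mult [simp]: "(- 1) ^ k * ((- 1) ^ k * x) = (x :: complex)"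
  by (simp add: mult.assoc[symmetric] power_mult_distrib[symmetric])

lemma pos_sign_self_mult [simp]: "pos_sign k K * (pos_sign k K * x) = x"
  by (simp add: pos_sign_def)

lemma card_subsets_of_card: "card (subsets_of_card c n) = c choose n"
  using n_subsets[of "{..<c}" n] by simp

text \<open>In ambient dimension n + m - 1 the source and the target of the degree n exterior minor map
  have the same dimension.\<close>

locale independent_exterior_minors =
  fixes n m :: nat and g :: "nat \<Rightarrow> nat \<Rightarrow> nat \<Rightarrow> complex"
  assumes n_pos: "0 < n"
    and independent: "\<And>\<tau>. (\<And>K. K \<in> subsets_of_card (n + m - 1) n \<Longrightarrow> exterior_minor m g [0..<n] \<tau> K = 0)
      \<Longrightarrow> \<forall>M\<in>msets m n. \<tau> M = 0"
begin

lemma exterior_minors_spanning: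
  "\<exists>\<tau>. \<forall>K\<in>subsets_of_card (n + m - 1) n. exterior_minor m g [0..<n] \<tau> K = Y K"
proof -
  let ?A = "\<lambda>K M. exterior_minor m g [0..<n] (\<lambda>N. if N = M then 1 else 0) K"
  have E: "exterior_minor m g [0..<n] \<tau> K = (\<Sum>M\<in>msets m n. ?A K M * \<tau> M)" for \<tau> K
    by (subst exterior_minor_basis_expand) (simp add: mult.commute)
  have "\<exists>\<tau>. \<forall>K\<in>subsets_of_card (n + m - 1) n. (\<Sum>M\<in>msets m n. ?A K M * \<tau> M) = Y K"
  proof (rule injective_square_system_solvable)
    show "card (subsets_of_card (n + m - 1) n) \<le> card (msets m n)"
      by (simp add: card_subsets_of_card card_multisets_of_size add.commute)
    show "finite (msets m n)" by (simp add: finite_multisets_of_size)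
    fix \<tau> assume "\<And>K. K \<in> subsets_of_card (n + m - 1) n \<Longrightarrow> (\<Sum>M\<in>msets m n. ?A K M * \<tau> M) = 0"
    then show "\<forall>M\<in>msets m n. \<tau> M = 0" using independent[of \<tau>] unfolding E[of \<tau>] by blast
  qed simp
  then show ?thesis unfolding E[symmetric] .
qed

definition other_rows :: "nat \<Rightarrow> nat list" where
  "other_rows l0 = [0..<l0] @ [Suc l0..<n]"

text \<open>Cofactor expansion: the minors of the rows other than l0 act as cofactors. Row l0 gives
  back the full minor up to sign, any other row gives a minor with a repeated row.\<close>

lemma exterior_minor_other_rows:
  assumes "l0 < n" "l < n" "finite K"
  shows "exterior_minor m g (l # other_rows l0) \<tau> K =
    (if l = l0 then (- 1) ^ l0 * exterior_minor m g [0..<n] \<tau> K else 0)"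
proof (cases "l = l0")
  case True
  have "[0..<n] = [0..<l0] @ l0 # [Suc l0..<n]"
    using upt_add_eq_append[of 0 l0 "n - l0"] upt_conv_Cons[of l0 n] assms by simp
  then have "exterior_minor m g [0..<n] \<tau> K = (- 1) ^ l0 * exterior_minor m g (l0 # other_rows l0) \<tau> K"
    using exterior_minor_move_to_front[OF assms(3), of m g "[0..<l0]" l0 "[Suc l0..<n]" \<tau>]
    by (simp add: other_rows_def del: exterior_minor.simps)
  then show ?thesis using True by (simp del: exterior_minor.simps)
next
  case False
  then have "l \<in> set (other_rows l0)" using assms by (auto simp: other_rows_def)
  then show ?thesis using exterior_minor_repeated_row[OF assms(3)] False by (simp del: exterior_minor.simps)
qed

text \<open>Unknowns and relations are equally many, since n (c choose n) = m (c choose (n - 1)) for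
  c = n + m - 1. So it is enough that every right-hand side is reached, and cofactors of a tensor
  with prescribed minors do that.\<close>

lemma wedge_rows_kernel_trivial:
  assumes "\<And>l K. l < n \<Longrightarrow> K \<in> subsets_of_card (n + m - 1) n \<Longrightarrow> (\<Sum>j<m. wedge (g l j) (y j) K) = 0"
    and "j < m" "L \<in> subsets_of_card (n + m - 1) (n - 1)"
  shows "y j L = 0"
proof -
  let ?c = "n + m - 1"
  define I where "I = {..<m} \<times> subsets_of_card ?c (n - 1)"
  define J where "J = {..<n} \<times> subsets_of_card ?c n"
  define A where "A lK jL = wedge (g (fst lK) (fst jL)) (\<lambda>K'. if K' = snd jL then 1 else 0) (snd lK)"
    for lK jL :: "nat \<times> nat set"
  have A: "(\<Sum>i\<in>I. A (l, K) i * x i) = (\<Sum>j<m. wedge (g l j) (\<lambda>L. x (j, L)) K)"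
    if "K \<in> subsets_of_card ?c n" for l K x
  proof -
    have "(\<Sum>j<m. wedge (g l j) (\<lambda>L. x (j, L)) K) = (\<Sum>j<m. \<Sum>L\<in>subsets_of_card ?c (n - 1). x (j, L) * A (l, K) (j, L))"
      unfolding A_def fst_conv snd_conv
      by (intro sum.cong refl wedge_basis_expand) (use that n_pos in simp)
    also have "\<dots> = (\<Sum>i\<in>I. A (l, K) i * x i)"
      unfolding I_def sum.cartesian_product by (intro sum.cong refl) (auto simp: mult.commute)
    finally show ?thesis by simp
  qed
  \<comment> \<open>With an empty H, exactness says that the kernel is zero.\<close>
  have "\<exists>h. \<forall>i\<in>I. y (fst i) (snd i) = (\<Sum>s\<in>{}. (\<lambda>_ _. 0) i (s::nat) * h s)"
  proof (rule kernel_eq_range_if_card)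
    show "finite J" "finite I" by (auto simp: I_def J_def)
    have "n * (?c choose n) = m * (?c choose (n - 1))"
      using times_binomial_Suc[of "n - 1" ?c] n_pos by simp
    then show "card I \<le> card ({}::nat set) + card J"
      unfolding I_def J_def card_cartesian_product card_subsets_of_card by simp
    fix j assume "j \<in> J"
    then obtain l K where "j = (l, K)" "l < n" "K \<in> subsets_of_card ?c n" by (auto simp: J_def)
    then show "(\<Sum>i\<in>I. A j i * y (fst i) (snd i)) = 0" using assms(1) A[of K l "\<lambda>i. y (fst i) (snd i)"] by simp
  next
    fix j0 assume "j0 \<in> J"
    then obtain l0 K0 where j0: "j0 = (l0, K0)" "l0 < n" "K0 \<in> subsets_of_card ?c n" by (auto simp: J_def)
    obtain t where t: "\<And>K. K \<in> subsets_of_card ?c n \<Longrightarrow> exterior_minor m g [0..<n] t K = (if K = K0 then 1 else 0)"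
      using exterior_minors_spanning[of "\<lambda>K. if K = K0 then 1 else 0"] by auto
    \<comment> \<open>The signed cofactors of t, a tensor whose minors vanish except at K0.\<close>
    define x where "x = (\<lambda>(j, L). (- 1) ^ l0 * exterior_minor m g (other_rows l0) (\<lambda>M. t (add_mset j M)) L)"
    have "(\<Sum>i\<in>I. A (l, K) i * x i) = (if (l, K) = j0 then 1 else 0)"
      if lK: "l < n" "K \<in> subsets_of_card ?c n" for l K
    proof -
      have "finite K" using lK finite_subset by blast
      have "(\<Sum>i\<in>I. A (l, K) i * x i) = (- 1) ^ l0 * exterior_minor m g (l # other_rows l0) t K"
        unfolding A[OF lK(2)] by (simp add: x_def wedge_scale sum_distrib_left)
      also have "\<dots> = (if l = l0 then exterior_minor m g [0..<n] t K else 0)"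
        using exterior_minor_other_rows[OF j0(2) lK(1) \<open>finite K\<close>] by (simp del: exterior_minor.simps)
      finally show ?thesis using t[OF lK(2)] j0 by auto
    qed
    then show "\<exists>x. \<forall>j\<in>J. (\<Sum>i\<in>I. A j i * x i) = (if j = j0 then 1 else 0)"
      by (intro exI[of _ x]) (auto simp: J_def)
  qed auto
  then have "\<forall>i\<in>I. y (fst i) (snd i) = 0" by simp
  moreover have "(j, L) \<in> I" using assms by (simp add: I_def)
  ultimately show ?thesis by fastforce
qed

text \<open>Families of the form r_j(M) = \<tau>(j + M) satisfy the relations because a row repeats.
  There are no others: for c = n + m - 1 one has m (c choose n) = ((c + 1) choose (n + 1)) + n (c
  choose (n + 1)), and the relations are independent since every right-hand side is reached.\<close>

lemma wedge_exterior_minors_kernel: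
  assumes "\<And>l K. l < n \<Longrightarrow> K \<in> subsets_of_card (n + m - 1) (Suc n) \<Longrightarrow>
      (\<Sum>j<m. wedge (g l j) (exterior_minor m g [0..<n] (r j)) K) = 0"
  shows "\<exists>\<tau>. \<forall>j<m. \<forall>M\<in>msets m n. r j M = \<tau> (add_mset j M)"
proof -
  let ?c = "n + m - 1"
  let ?E = "exterior_minor m g [0..<n]"
  have finm: "finite (msets m k)" for k by (simp add: finite_multisets_of_size)
  define I where "I = {..<m} \<times> msets m n"
  define J where "J = {..<n} \<times> subsets_of_card ?c (Suc n)"
  define H where "H = msets m (Suc n)"
  define A where "A lK jM = wedge (g (fst lK) (fst jM)) (?E (\<lambda>N. if N = snd jM then 1 else 0)) (snd lK)"
    for lK :: "nat \<times> nat set" and jM :: "nat \<times> nat multiset"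
  define G where "G jM N = (if N = add_mset (fst jM) (snd jM) then 1 else 0 :: complex)"
    for jM :: "nat \<times> nat multiset" and N
  have A: "(\<Sum>i\<in>I. A (l, K) i * x i) = (\<Sum>j<m. wedge (g l j) (?E (\<lambda>M. x (j, M))) K)" for l K x
  proof -
    have "(\<Sum>j<m. wedge (g l j) (?E (\<lambda>M. x (j, M))) K) =
        (\<Sum>j<m. wedge (g l j) (\<lambda>K. \<Sum>M\<in>msets m n. x (j, M) * ?E (\<lambda>N. if N = M then 1 else 0) K) K)"
      by (rule sum.cong[OF refl], rule wedge_cong, subst exterior_minor_basis_expand) simp
    also have "\<dots> = (\<Sum>j<m. \<Sum>M\<in>msets m n. x (j, M) * A (l, K) (j, M))"
      by (simp add: wedge_sum wedge_scale A_def)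
    also have "\<dots> = (\<Sum>i\<in>I. A (l, K) i * x i)"
      unfolding I_def sum.cartesian_product by (intro sum.cong refl) (auto simp: mult.commute)
    finally show ?thesis by simp
  qed
  have G: "(\<Sum>N\<in>H. G (j, M) N * y N) = y (add_mset j M)" if "j < m" "M \<in> msets m n" for j M y
  proof -
    have "(\<Sum>N\<in>H. G (j, M) N * y N) = (\<Sum>N\<in>H. if N = add_mset j M then y N else 0)"
      by (intro sum.cong) (auto simp: G_def)
    also have "\<dots> = y (add_mset j M)" using that by (subst sum.delta) (auto simp: H_def finm)
    finally show ?thesis .
  qed
  have "\<exists>\<tau>. \<forall>i\<in>I. r (fst i) (snd i) = (\<Sum>N\<in>H. G i N * \<tau> N)"
  proof (rule kernel_eq_range_if_card)
    show "finite J" "finite I" "finite H" by (auto simp: I_def J_def H_def finm)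
    have "m * (?c choose n) \<le> (Suc ?c choose Suc n) + n * (?c choose Suc n)"
    proof (cases m)
      case (Suc m')
      have "Suc n * (?c choose Suc n) = m' * (?c choose n)"
        using times_binomial_Suc[of n ?c] Suc by simp
      then show ?thesis using Suc by simp
    qed simp
    then show "card I \<le> card H + card J"
      unfolding I_def J_def H_def card_cartesian_product card_subsets_of_card
      using n_pos by (simp add: card_multisets_of_size add.commute)
    fix j assume "j \<in> J"
    then obtain l K where "j = (l, K)" "l < n" "K \<in> subsets_of_card ?c (Suc n)" by (auto simp: J_def)
    then show "(\<Sum>i\<in>I. A j i * r (fst i) (snd i)) = 0" using assms A[of l K "\<lambda>i. r (fst i) (snd i)"] by simp
  next
    fix y assume "\<And>i. i \<in> I \<Longrightarrow> (\<Sum>N\<in>H. G i N * y N) = 0"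
    then have *: "y (add_mset j M) = 0" if "j < m" "M \<in> msets m n" for j M
      using G[OF that, of y] that by (simp add: I_def)
    show "\<forall>N\<in>H. y N = 0"
    proof
      fix N assume N: "N \<in> H"
      then have "size N = Suc n" by (simp add: H_def multisets_of_size_def)
      then obtain j M where "N = add_mset j M" by (metis size_eq_Suc_imp_eq_union)
      with N * show "y N = 0" by (simp add: H_def)
    qed
  next
    fix j N assume "j \<in> J" "N \<in> H"
    then obtain l K where j: "j = (l, K)" "l < n" "K \<subseteq> {..<?c}" by (auto simp: J_def)
    have "finite K" using j finite_subset by blast
    have "(\<Sum>i\<in>I. A j i * G i N) = exterior_minor m g (l # [0..<n]) (\<lambda>N'. if N = N' then 1 else 0) K"
      unfolding j A by (simp add: G_def)
    also have "\<dots> = 0" by (rule exterior_minor_repeated_row) (use \<open>finite K\<close> j in auto)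
    finally show "(\<Sum>i\<in>I. A j i * G i N) = 0" .
  next
    fix j0 assume "j0 \<in> J"
    then obtain l0 K0 where j0: "j0 = (l0, K0)" "l0 < n" "K0 \<in> subsets_of_card ?c (Suc n)" by (auto simp: J_def)
    then obtain k0 where k0: "k0 \<in> K0" by fastforce
    define K1 where "K1 = K0 - {k0}"
    obtain t where t: "\<And>K. K \<in> subsets_of_card ?c n \<Longrightarrow> ?E t K = (if K = K1 then 1 else 0)"
      using exterior_minors_spanning[of "\<lambda>K. if K = K1 then 1 else 0"] by auto
    \<comment> \<open>Wedging with v takes e_K1 to a multiple of e_K0. The two signs cancel
      \<open>pos_sign\<close> and the sign from \<open>other_rows\<close>; the minus cancels the one
      from moving v past g l j.\<close>
    define v where "v k = (if k = k0 then - pos_sign k0 K0 * (- 1) ^ l0 else 0)" for k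
    let ?R = "\<lambda>j. exterior_minor m g (other_rows l0) (\<lambda>M. t (add_mset j M))"
    \<comment> \<open>The wedge of v with a cofactor has degree n again, so by spanning it is the
      minor of some tensor.\<close>
    have "\<forall>j. \<exists>\<tau>. \<forall>K\<in>subsets_of_card ?c n. ?E \<tau> K = wedge v (?R j) K"
      using exterior_minors_spanning by blast
    then obtain \<rho> where \<rho>: "\<And>j K. K \<in> subsets_of_card ?c n \<Longrightarrow> ?E (\<rho> j) K = wedge v (?R j) K" by metis
    have "(\<Sum>i\<in>I. A (l, K) i * \<rho> (fst i) (snd i)) = (if (l, K) = j0 then 1 else 0)"
      if lK: "l < n" "K \<in> subsets_of_card ?c (Suc n)" for l K
    proof -
      have "finite K" using lK finite_subset by blast
      have sub: "K - {k} \<in> subsets_of_card ?c n" if "k \<in> K" for k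
        using lK that \<open>finite K\<close> by (auto simp: card_Diff_singleton)
      have "(\<Sum>i\<in>I. A (l, K) i * \<rho> (fst i) (snd i)) = (\<Sum>j<m. wedge (g l j) (?E (\<rho> j)) K)"
        unfolding A by simp
      also have "\<dots> = (\<Sum>j<m. wedge (g l j) (wedge v (?R j)) K)"
        by (intro sum.cong refl wedge_cong \<rho> sub)
      also have "\<dots> = - wedge v (exterior_minor m g (l # other_rows l0) t) K"
        unfolding exterior_minor_Cons wedge_sum sum_negf[symmetric]
        by (intro sum.cong refl wedge_anticommute \<open>finite K\<close>)
      also have "wedge v (exterior_minor m g (l # other_rows l0) t) K =
          wedge v (\<lambda>L. if l = l0 then (- 1) ^ l0 * ?E t L else 0) K"
        using exterior_minor_other_rows[OF j0(2) lK(1)] \<open>finite K\<close>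
        by (intro wedge_cong) (simp del: exterior_minor.simps)
      also have "\<dots> = (if l = l0 then (- 1) ^ l0 * wedge v (?E t) K else 0)"
        by (simp add: wedge_scale)
      also have "wedge v (?E t) K = wedge v (\<lambda>L. if L = K1 then 1 else 0) K"
        by (intro wedge_cong t sub)
      also have "\<dots> = (\<Sum>k\<in>K. if k = k0 then (if K = K0 then - ((- 1) ^ l0) else 0) else 0)"
        unfolding wedge_def
      proof (intro sum.cong refl)
        fix k assume "k \<in> K"
        then have "K - {k0} = K1 \<longleftrightarrow> K = K0" if "k = k0" using k0 that by (auto simp: K1_def)
        then show "pos_sign k K * v k * (if K - {k} = K1 then 1 else 0) =
            (if k = k0 then if K = K0 then - ((- 1) ^ l0) else 0 else 0)"
          by (auto simp: v_def)
      qed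
      also have "\<dots> = (if K = K0 then - ((- 1) ^ l0) else 0)"
        using \<open>finite K\<close> k0 by (auto simp: sum.delta)
      finally show ?thesis using j0 by (auto simp: power_mult_distrib[symmetric])
    qed
    then show "\<exists>x. \<forall>j\<in>J. (\<Sum>i\<in>I. A j i * x i) = (if j = j0 then 1 else 0)"
      by (intro exI[of _ "\<lambda>i. \<rho> (fst i) (snd i)"]) (auto simp: J_def)
  qed
  then obtain \<tau> where "\<And>i. i \<in> I \<Longrightarrow> r (fst i) (snd i) = (\<Sum>N\<in>H. G i N * \<tau> N)" by blast
  then have "\<forall>j<m. \<forall>M\<in>msets m n. r j M = \<tau> (add_mset j M)"
    using G by (fastforce simp: I_def)
  then show ?thesis by blast
qed

end

section \<open>Exterior minors as sums of determinants\<close>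

lemma detn_eq_det: "detn n M = det (mat n n (\<lambda>(i, j). M i j))"
  unfolding detn_def
  by (subst det_def'[of _ n]) (auto simp: atLeast0LessThan intro!: sum.cong prod.cong dest: permutes_in_image)

lemma detn_cong:
  assumes "\<And>s u. s < n \<Longrightarrow> u < n \<Longrightarrow> M s u = M' s u"
  shows "detn n M = detn n M'"
  unfolding detn_eq_det using assms by (intro arg_cong[of _ _ det] eq_matI) auto

lemma detn_Suc_first_row:
  "detn (Suc n) M = (\<Sum>u<Suc n. (- 1) ^ u * M 0 u * detn n (\<lambda>s t. M (Suc s) (if t < u then t else Suc t)))"
proof -
  let ?A = "mat (Suc n) (Suc n) (\<lambda>(i, j). M i j)"
  have "det ?A = (\<Sum>u<Suc n. ?A $$ (0, u) * cofactor ?A 0 u)"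
    by (rule laplace_expansion_row) auto
  also have "\<dots> = (\<Sum>u<Suc n. (- 1) ^ u * M 0 u * detn n (\<lambda>s t. M (Suc s) (if t < u then t else Suc t)))"
  proof (intro sum.cong refl)
    fix u assume u: "u \<in> {..<Suc n}"
    have "mat_delete ?A 0 u = mat n n (\<lambda>(s, t). M (Suc s) (if t < u then t else Suc t))"
      using u by (intro eq_matI) (auto simp: mat_delete_def)
    then show "?A $$ (0, u) * cofactor ?A 0 u = (- 1) ^ u * M 0 u * detn n (\<lambda>s t. M (Suc s) (if t < u then t else Suc t))"
      using u by (simp add: cofactor_def detn_eq_det)
  qed
  finally show ?thesis by (simp add: detn_eq_det)
qed

lemma detn_Suc_last_column:
  "detn (Suc n) M = (\<Sum>s<Suc n. M s n * ((- 1) ^ (s + n) * detn n (\<lambda>s' t. M (if s' < s then s' else Suc s') t)))"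
proof -
  let ?A = "mat (Suc n) (Suc n) (\<lambda>(i, j). M i j)"
  have "det ?A = (\<Sum>s<Suc n. ?A $$ (s, n) * cofactor ?A s n)"
    by (rule laplace_expansion_column) auto
  also have "\<dots> = (\<Sum>s<Suc n. M s n * ((- 1) ^ (s + n) * detn n (\<lambda>s' t. M (if s' < s then s' else Suc s') t)))"
  proof (intro sum.cong refl)
    fix s assume s: "s \<in> {..<Suc n}"
    have "mat_delete ?A s n = mat n n (\<lambda>(s', t). M (if s' < s then s' else Suc s') t)"
      using s by (intro eq_matI) (auto simp: mat_delete_def)
    then show "?A $$ (s, n) * cofactor ?A s n = M s n * ((- 1) ^ (s + n) * detn n (\<lambda>s' t. M (if s' < s then s' else Suc s') t))"
      using s by (simp add: cofactor_def detn_eq_det)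
  qed
  finally show ?thesis by (simp add: detn_eq_det)
qed

lemma detn_transpose: "detn n (\<lambda>s u. M u s) = detn n M"
proof -
  have "mat n n (\<lambda>(i, j). M j i) = transpose_mat (mat n n (\<lambda>(i, j). M i j))"
    by (intro eq_matI) auto
  then show ?thesis unfolding detn_eq_det using det_transpose[of "mat n n (\<lambda>(i, j). M i j)" n] by simp
qed

lemma detn_permute_columns:
  assumes "p permutes {..<n}"
  shows "detn n (\<lambda>s u. M s (p u)) = of_int (sign p) * detn n M"
proof -
  have p: "p permutes {0..<n}" using assms by (simp add: atLeast0LessThan)
  let ?A = "mat n n (\<lambda>(i, j). M j i)"
  have "mat n n (\<lambda>(i, j). ?A $$ (p i, j)) = mat n n (\<lambda>(i, j). M j (p i))"
    using permutes_in_image[OF p] by (intro eq_matI) auto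
  then have "detn n (\<lambda>u s. M s (p u)) = of_int (sign p) * detn n (\<lambda>u s. M s u)"
    using det_permute_rows[OF _ p, of ?A] by (simp add: detn_eq_det)
  then show ?thesis using detn_transpose[of n "\<lambda>s u. M s (p u)"] detn_transpose[of n M] by simp
qed

lemma detn_equal_columns:
  assumes "u < n" "u' < n" "u \<noteq> u'" "\<And>s. s < n \<Longrightarrow> M s u = M s u'"
  shows "detn n M = 0"
  unfolding detn_eq_det
  by (rule det_identical_columns[of _ n u u']) (use assms in \<open>auto intro!: eq_vecI\<close>)

lemma remove1_nth_distinct:
  assumes "distinct xs" "u < length xs"
  shows "remove1 (xs ! u) xs = take u xs @ drop (Suc u) xs"
proof -
  have eq: "xs = take u xs @ xs ! u # drop (Suc u) xs" using assms by (simp add: id_take_nth_drop)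
  then have "xs ! u \<notin> set (take u xs)" using assms
    by (metis distinct_append disjoint_insert(1) list.simps(15))
  then show ?thesis by (subst (2) eq) (simp add: remove1_append)
qed

lemma sorted_list_of_set_remove_nth:
  assumes "finite K" "u < card K" "t < card K - 1"
  shows "sorted_list_of_set (K - {sorted_list_of_set K ! u}) ! t =
    sorted_list_of_set K ! (if t < u then t else Suc t)"
proof -
  let ?xs = "sorted_list_of_set K"
  have "sorted_list_of_set (K - {?xs ! u}) = take u ?xs @ drop (Suc u) ?xs"
    using assms by (simp add: sorted_list_of_set_remove remove1_nth_distinct)
  then show ?thesis using assms by (auto simp: nth_append)
qed

lemma pos_sign_nth_sorted_list:
  assumes "finite K" "u < card K"
  shows "pos_sign (sorted_list_of_set K ! u) K = (- 1) ^ u"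
proof -
  let ?xs = "sorted_list_of_set K"
  have len: "length ?xs = card K" and str: "sorted_wrt (<) ?xs" by auto
  have "{i\<in>K. i < ?xs ! u} = (!) ?xs ` {..<u}"
  proof (intro equalityI subsetI)
    fix i assume "i \<in> {i\<in>K. i < ?xs ! u}"
    then have "i \<in> set ?xs" "i < ?xs ! u" using assms by auto
    then obtain v where v: "v < length ?xs" "i = ?xs ! v" by (auto simp: in_set_conv_nth)
    have "v < u"
    proof (rule ccontr)
      assume "\<not> v < u"
      then have "?xs ! u \<le> ?xs ! v" using v assms len by (intro sorted_nth_mono) auto
      with v \<open>i < ?xs ! u\<close> show False by simp
    qed
    then show "i \<in> (!) ?xs ` {..<u}" using v by auto
  next
    fix i assume "i \<in> (!) ?xs ` {..<u}"
    then obtain v where v: "v < u" "i = ?xs ! v" by auto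
    then have "i < ?xs ! u" using sorted_wrt_nth_less[OF str, of v u] assms len by simp
    moreover have "i \<in> set ?xs" unfolding v(2) by (rule nth_mem) (use v assms len in simp)
    ultimately show "i \<in> {i\<in>K. i < ?xs ! u}" using assms by auto
  qed
  moreover have "inj_on ((!) ?xs) {..<u}"
    using assms len by (intro inj_on_nth) auto
  ultimately show ?thesis by (simp add: pos_sign_def card_image)
qed

text \<open>Left multiplication by a vector is Laplace expansion along the first row;
  \<open>pos_sign_nth_sorted_list\<close> turns the sign of an index into the sign of its
  position.\<close>

lemma foldr_wedge_eq_detn:
  assumes "finite K" "card K = length vs"
  shows "foldr wedge vs (\<lambda>_. 1) K = detn (length vs) (\<lambda>s u. (vs ! s) (sorted_list_of_set K ! u))"
  using assms
proof (induction vs arbitrary: K)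
  case Nil
  then show ?case by (simp add: detn_def)
next
  case (Cons v vs)
  let ?n = "length vs"
  let ?xs = "sorted_list_of_set K"
  have len: "length ?xs = Suc ?n" using Cons.prems by simp
  have bij: "bij_betw ((!) ?xs) {..<Suc ?n} K"
    using Cons.prems by (intro bij_betw_nth) auto
  have "foldr wedge (v # vs) (\<lambda>_. 1) K = (\<Sum>k\<in>K. pos_sign k K * v k * foldr wedge vs (\<lambda>_. 1) (K - {k}))"
    by (simp add: wedge_def)
  also have "\<dots> = (\<Sum>u<Suc ?n. pos_sign (?xs ! u) K * v (?xs ! u) * foldr wedge vs (\<lambda>_. 1) (K - {?xs ! u}))"
    by (rule sum.reindex_bij_betw[OF bij, symmetric])
  also have "\<dots> = (\<Sum>u<Suc ?n. (- 1) ^ u * v (?xs ! u) * detn ?n (\<lambda>s t. (vs ! s) (?xs ! (if t < u then t else Suc t))))"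
  proof (intro sum.cong refl)
    fix u assume u: "u \<in> {..<Suc ?n}"
    then have mem: "?xs ! u \<in> K" using bij by (auto simp: bij_betw_def)
    have "foldr wedge vs (\<lambda>_. 1) (K - {?xs ! u}) = detn ?n (\<lambda>s t. (vs ! s) (sorted_list_of_set (K - {?xs ! u}) ! t))"
      using Cons mem by (intro Cons.IH) auto
    also have "\<dots> = detn ?n (\<lambda>s t. (vs ! s) (?xs ! (if t < u then t else Suc t)))"
      using sorted_list_of_set_remove_nth[OF Cons.prems(1), of u] u Cons.prems by (intro detn_cong) auto
    finally show "pos_sign (?xs ! u) K * v (?xs ! u) * foldr wedge vs (\<lambda>_. 1) (K - {?xs ! u}) =
        (- 1) ^ u * v (?xs ! u) * detn ?n (\<lambda>s t. (vs ! s) (?xs ! (if t < u then t else Suc t)))"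
      using pos_sign_nth_sorted_list[OF Cons.prems(1), of u] u Cons.prems by simp
  qed
  also have "\<dots> = detn (Suc ?n) (\<lambda>s u. ((v # vs) ! s) (?xs ! u))"
    by (simp add: detn_Suc_first_row)
  finally show ?case by simp
qed

text \<open>Contracting a pure power of z replaces every row of linear forms by its value at z. So
  if the minors kill this power, the matrix of values at z drops rank.\<close>

lemma exterior_minor_pure_power:
  "exterior_minor b g ls (\<lambda>M. \<Prod>j\<in>#M. z j) = foldr wedge (map (\<lambda>l k. \<Sum>j<b. z j * g l j k) ls) (\<lambda>_. 1)"
proof (induction ls)
  case Nil
  then show ?case by (simp add: fun_eq_iff)
next
  case (Cons l ls)
  let ?W = "foldr wedge (map (\<lambda>l k. \<Sum>j<b. z j * g l j k) ls) (\<lambda>_. 1)"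
  have "exterior_minor b g ls (\<lambda>M. \<Prod>i\<in>#add_mset j M. z i) = (\<lambda>K. z j * ?W K)" for j
    by (rule ext) (simp add: exterior_minor_scale Cons.IH)
  then show ?case
    by (intro ext) (simp add: wedge_scale wedge_sum_left)
qed

lemma idx_lists_Suc: "idx_lists b (Suc n) = (\<lambda>(j, js). j # js) ` ({..<b} \<times> idx_lists b n)"
  by (auto simp: idx_lists_def length_Suc_conv image_iff)

lemma exterior_minor_eq_sum:
  "exterior_minor b g ls \<tau> K =
    (\<Sum>js\<in>idx_lists b (length ls). \<tau> (mset js) * foldr wedge (map2 g ls js) (\<lambda>_. 1) K)"
proof (induction ls arbitrary: \<tau> K)
  case Nil
  have "idx_lists b 0 = {[]}" by (auto simp: idx_lists_def)
  then show ?case by simp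
next
  case (Cons l ls)
  have "exterior_minor b g (l # ls) \<tau> K = (\<Sum>j<b. \<Sum>js\<in>idx_lists b (length ls).
      \<tau> (add_mset j (mset js)) * wedge (g l j) (foldr wedge (map2 g ls js) (\<lambda>_. 1)) K)"
    unfolding exterior_minor.simps
  proof (rule sum.cong[OF refl])
    fix j
    have "wedge (g l j) (exterior_minor b g ls (\<lambda>M. \<tau> (add_mset j M))) K =
      wedge (g l j) (\<lambda>K. \<Sum>js\<in>idx_lists b (length ls). \<tau> (add_mset j (mset js)) * foldr wedge (map2 g ls js) (\<lambda>_. 1) K) K"
      by (rule wedge_cong) (rule Cons.IH)
    then show "wedge (g l j) (exterior_minor b g ls (\<lambda>M. \<tau> (add_mset j M))) K =
      (\<Sum>js\<in>idx_lists b (length ls). \<tau> (add_mset j (mset js)) * wedge (g l j) (foldr wedge (map2 g ls js) (\<lambda>_. 1)) K)"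
      by (simp add: wedge_sum wedge_scale)
  qed
  also have "\<dots> = (\<Sum>(j, js)\<in>{..<b} \<times> idx_lists b (length ls).
      \<tau> (mset (j # js)) * foldr wedge (map2 g (l # ls) (j # js)) (\<lambda>_. 1) K)"
    by (simp add: sum.cartesian_product)
  also have "\<dots> = (\<Sum>js\<in>idx_lists b (length (l # ls)). \<tau> (mset js) * foldr wedge (map2 g (l # ls) js) (\<lambda>_. 1) K)"
    unfolding length_Cons idx_lists_Suc
    by (subst sum.reindex) (auto simp: inj_on_def intro!: sum.cong)
  finally show ?case .
qed

lemma exterior_minor_eq_sum_detn:
  assumes "finite K" "card K = n"
  shows "exterior_minor b g [0..<n] \<tau> K =
    (\<Sum>js\<in>idx_lists b n. \<tau> (mset js) * detn n (\<lambda>s u. g s (js ! s) (sorted_list_of_set K ! u)))"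
proof -
  have "foldr wedge (map2 g [0..<n] js) (\<lambda>_. 1) K = detn n (\<lambda>s u. g s (js ! s) (sorted_list_of_set K ! u))"
    if "js \<in> idx_lists b n" for js
  proof -
    have "length js = n" using that by (simp add: idx_lists_def)
    then show ?thesis using foldr_wedge_eq_detn[OF assms(1), of "map2 g [0..<n] js"] assms
      by (auto intro!: detn_cong)
  qed
  then show ?thesis by (simp add: exterior_minor_eq_sum)
qed

text \<open>A column choice either repeats a column, and every determinant vanishes, or permutes a
  sorted one, with a sign common to all x.\<close>

lemma sum_detn_zero_all_columns:
  assumes "\<And>K. K \<in> subsets_of_card c n \<Longrightarrow> (\<Sum>x\<in>S. a x * detn n (\<lambda>s u. v x s (sorted_list_of_set K ! u))) = 0"
    and \<kappa>: "\<And>u. u < n \<Longrightarrow> \<kappa> u < c"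
  shows "(\<Sum>x\<in>S. a x * detn n (\<lambda>s u. v x s (\<kappa> u))) = 0"
proof (cases "inj_on \<kappa> {..<n}")
  case False
  then obtain u u' where "u < n" "u' < n" "u \<noteq> u'" "\<kappa> u = \<kappa> u'" by (auto simp: inj_on_def)
  then have "detn n (\<lambda>s u. v x s (\<kappa> u)) = 0" for x by (intro detn_equal_columns[of u n u']) auto
  then show ?thesis by simp
next
  case True
  define K where "K = \<kappa> ` {..<n}"
  have K: "K \<in> subsets_of_card c n" "finite K" using True \<kappa> by (auto simp: K_def card_image)
  let ?xs = "sorted_list_of_set K"
  have bij: "bij_betw ((!) ?xs) {..<n} K" using K by (intro bij_betw_nth) auto
  define p where "p u = (if u < n then inv_into {..<n} ((!) ?xs) (\<kappa> u) else u)" for u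
  have "bij_betw (inv_into {..<n} ((!) ?xs) \<circ> \<kappa>) {..<n} {..<n}"
    by (rule bij_betw_trans[of _ _ K]) (use True bij in \<open>auto simp: bij_betw_def K_def bij_betw_inv_into[unfolded bij_betw_def]\<close>)
  then have "bij_betw p {..<n} {..<n}"
    by (rule bij_betw_cong[THEN iffD1, rotated]) (auto simp: p_def)
  then have p: "p permutes {..<n}" by (intro bij_imp_permutes) (auto simp: p_def)
  have xp: "?xs ! p u = \<kappa> u" if "u < n" for u
  proof -
    have "\<kappa> u \<in> (!) ?xs ` {..<n}" using bij that by (simp add: bij_betw_def K_def)
    then show ?thesis using that by (simp add: p_def f_inv_into_f)
  qed
  have "(\<Sum>x\<in>S. a x * detn n (\<lambda>s u. v x s (\<kappa> u))) =
      (\<Sum>x\<in>S. a x * (of_int (sign p) * detn n (\<lambda>s u. v x s (?xs ! u))))"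
  proof (intro sum.cong refl)
    fix x
    have "detn n (\<lambda>s u. v x s (\<kappa> u)) = detn n (\<lambda>s u. v x s (?xs ! p u))" by (rule detn_cong) (simp add: xp)
    then show "a x * detn n (\<lambda>s u. v x s (\<kappa> u)) = a x * (of_int (sign p) * detn n (\<lambda>s u. v x s (?xs ! u)))"
      using detn_permute_columns[OF p, of "\<lambda>s u. v x s (?xs ! u)"] by simp
  qed
  also have "\<dots> = of_int (sign p) * (\<Sum>x\<in>S. a x * detn n (\<lambda>s u. v x s (?xs ! u)))"
    by (simp add: sum_distrib_left mult_ac)
  finally show ?thesis using assms(1)[OF K(1)] by simp
qed

text \<open>Either the minors of the first n rows vanish already, or the cofactors of a nonzero one
  along a variable last column are the coefficients. Column choices \<kappa> may repeat, so any k
  can be that last column.\<close>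

lemma rows_dependent_if_minors_vanish:
  assumes "\<And>\<kappa>. (\<And>u. u < n \<Longrightarrow> \<kappa> u < c) \<Longrightarrow> detn n (\<lambda>s u. f s (\<kappa> u)) = 0"
  shows "\<exists>u. (\<exists>l<n. u l \<noteq> 0) \<and> (\<forall>k<c. (\<Sum>l<n. u l * f l k) = 0)"
  using assms
proof (induction n)
  case 0
  then show ?case by (auto simp: detn_def)
next
  case (Suc n)
  show ?case
  proof (cases "\<forall>\<kappa>. (\<forall>u<n. \<kappa> u < c) \<longrightarrow> detn n (\<lambda>s u. f s (\<kappa> u)) = 0")
    case True
    then obtain u where "\<exists>l<n. u l \<noteq> 0" "\<forall>k<c. (\<Sum>l<n. u l * f l k) = 0" using Suc.IH by auto
    then show ?thesis by (intro exI[of _ "u(n := 0)"]) (auto intro: less_SucI)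
  next
    case False
    then obtain \<kappa> where \<kappa>: "\<forall>u<n. \<kappa> u < c" "detn n (\<lambda>s u. f s (\<kappa> u)) \<noteq> 0" by auto
    define w where "w s = (- 1) ^ (s + n) * detn n (\<lambda>s' t. f (if s' < s then s' else Suc s') (\<kappa> t))" for s
    have "(\<Sum>s<Suc n. w s * f s k) = 0" if "k < c" for k
    proof -
      have "detn (Suc n) (\<lambda>s u. f s ((\<kappa>(n := k)) u)) = 0"
        by (rule Suc.prems) (use \<kappa> that in \<open>auto simp: less_Suc_eq\<close>)
      moreover have "detn n (\<lambda>s' t. f (if s' < s then s' else Suc s') ((\<kappa>(n := k)) t)) =
          detn n (\<lambda>s' t. f (if s' < s then s' else Suc s') (\<kappa> t))" for s
        by (rule detn_cong) auto
      ultimately show ?thesis unfolding detn_Suc_last_column by (simp add: w_def mult.commute)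
    qed
    moreover have "w n \<noteq> 0"
    proof -
      have "detn n (\<lambda>s' t. f (if s' < n then s' else Suc s') (\<kappa> t)) = detn n (\<lambda>s u. f s (\<kappa> u))"
        by (rule detn_cong) auto
      then show ?thesis using \<kappa> by (simp add: w_def)
    qed
    ultimately show ?thesis by (intro exI[of _ w]) auto
  qed
qed

section \<open>Adding one column\<close>

text \<open>1-genericity as absence of zero products instead of injectivity. u and \<beta> are not
  cut off outside the index range, hence the conclusion speaks only of the coordinates within
  it.\<close>

definition nondegenerate :: "nat \<Rightarrow> nat \<Rightarrow> nat \<Rightarrow> (nat \<Rightarrow> nat \<Rightarrow> nat \<Rightarrow> complex) \<Rightarrow> bool" where
  "nondegenerate n b c g \<longleftrightarrow> (\<forall>u \<beta>. (\<forall>k<c. (\<Sum>l<n. \<Sum>j<b. u l * \<beta> j * g l j k) = 0) \<longrightarrow>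
     (\<forall>l<n. u l = 0) \<or> (\<forall>j<b. \<beta> j = 0))"

context independent_exterior_minors
begin

lemma add_mset_in_msets_n_iff [simp]: "add_mset j M \<in> msets b n \<longleftrightarrow> j < b \<and> M \<in> msets b (n - 1)"
  using add_mset_in_msets_iff[of j M b "n - 1"] n_pos by simp

lemma msets_remove:
  assumes "N \<in> msets b n" "j \<in># N"
  obtains M where "N = add_mset j M" "M \<in> msets b (n - 1)"
proof -
  have "N = add_mset j (N - {#j#})" using assms by simp
  then show ?thesis using that assms add_mset_in_msets_n_iff by metis
qed

lemma msets_Suc_avoiding: "N \<in> msets (Suc m) k \<Longrightarrow> m \<notin># N \<Longrightarrow> N \<in> msets m k"
  by (fastforce simp: multisets_of_size_def less_Suc_eq)

text \<open>The annihilator, in the dual of the forms of degree n on the (m + 1)-dimensional B, of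
  the minors from the first c columns. For c = n + m - 1 it carries the coordinate operators; for c
  = n + m it is the subspace T that has to vanish.\<close>

definition minor_kernel :: "nat \<Rightarrow> (nat multiset \<Rightarrow> complex) set" where
  "minor_kernel c = {t. (\<forall>M. M \<notin> msets (Suc m) n \<longrightarrow> t M = 0) \<and>
     (\<forall>K\<in>subsets_of_card c n. exterior_minor (Suc m) g [0..<n] t K = 0)}"

lemma lin_subspace_minor_kernel: "lin_subspace (minor_kernel c)"
  unfolding lin_subspace_def minor_kernel_def by (auto simp: exterior_minor_zero exterior_minor_lin)

lemma minor_kernel_mono: "minor_kernel (n + m) \<subseteq> minor_kernel (n + m - 1)"
proof -
  have "subsets_of_card (n + m - 1) n \<subseteq> subsets_of_card (n + m) n" by auto
  then show ?thesis unfolding minor_kernel_def by blast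
qed

text \<open>The difference vanishes on multisets containing m, so it is a tensor on B', where the
  minors are independent.\<close>

lemma minor_kernel_eqI:
  assumes r: "r \<in> minor_kernel (n + m - 1)" "r' \<in> minor_kernel (n + m - 1)"
    and eq: "\<And>M. M \<in> msets (Suc m) (n - 1) \<Longrightarrow> r (add_mset m M) = r' (add_mset m M)"
  shows "r = r'"
proof -
  define d where "d = (\<lambda>M. 1 * r M + (- 1) * r' M)"
  have dker: "d \<in> minor_kernel (n + m - 1)"
    unfolding d_def using r lin_subspaceD[OF lin_subspace_minor_kernel] by blast
  have d0: "d N = 0" if "N \<in> msets (Suc m) n" "m \<in># N" for N
    by (rule msets_remove[OF that]) (simp add: d_def eq)
  have "exterior_minor m g [0..<n] d K = 0" if "K \<in> subsets_of_card (n + m - 1) n" for K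
  proof -
    have "exterior_minor (Suc m) g [0..<n] d K = exterior_minor m g [0..<n] d K"
      by (rule exterior_minor_restrict) (use d0 in simp)
    then show ?thesis using dker that by (simp add: minor_kernel_def)
  qed
  then have "\<forall>M\<in>msets m n. d M = 0" by (rule independent)
  then have "d N = 0" for N
    using d0[of N] dker msets_Suc_avoiding[of N n] by (cases "N \<in> msets (Suc m) n") (auto simp: minor_kernel_def)
  then show ?thesis by (auto simp: d_def fun_eq_iff)
qed

text \<open>Prescribe the values on multisets containing m; the minors of that tensor are cancelled
  by a tensor on B', since the minors there span. With \<open>minor_kernel_eqI\<close>, the values
  at m + M are free coordinates on the kernel.\<close>

lemma minor_kernel_extension:
  "\<exists>r\<in>minor_kernel (n + m - 1). \<forall>M\<in>msets (Suc m) (n - 1). r (add_mset m M) = f M"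
proof -
  define t where "t N = (if N \<in> msets (Suc m) n \<and> m \<in># N then f (N - {#m#}) else 0)" for N
  obtain \<tau> where \<tau>: "\<And>K. K \<in> subsets_of_card (n + m - 1) n \<Longrightarrow>
      exterior_minor m g [0..<n] \<tau> K = - exterior_minor (Suc m) g [0..<n] t K"
    using exterior_minors_spanning[of "\<lambda>K. - exterior_minor (Suc m) g [0..<n] t K"] by auto
  define \<tau>' where "\<tau>' N = (if N \<in> msets m n then \<tau> N else 0)" for N
  have nm: "m \<notin># N" if "N \<in> msets m k" for N k using that by (auto simp: multisets_of_size_def)
  have "exterior_minor (Suc m) g [0..<n] \<tau>' K = exterior_minor m g [0..<n] \<tau>' K" for K
    by (rule exterior_minor_restrict) (use nm in \<open>auto simp: \<tau>'_def\<close>)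
  moreover have "exterior_minor m g [0..<n] \<tau>' K = exterior_minor m g [0..<n] \<tau> K" for K
    by (rule exterior_minor_cong) (simp add: \<tau>'_def)
  ultimately have "exterior_minor (Suc m) g [0..<n] (\<lambda>N. t N + \<tau>' N) K = 0"
    if "K \<in> subsets_of_card (n + m - 1) n" for K
    using \<tau>[OF that] by (simp add: exterior_minor_add)
  moreover have "msets m n \<subseteq> msets (Suc m) n" by (intro multisets_of_size_mono) auto
  ultimately have "(\<lambda>N. t N + \<tau>' N) \<in> minor_kernel (n + m - 1)"
    by (auto simp: minor_kernel_def t_def \<tau>'_def)
  moreover have "t (add_mset m M) + \<tau>' (add_mset m M) = f M" if "M \<in> msets (Suc m) (n - 1)" for M
    using that nm[of "add_mset m M" n] by (auto simp: t_def \<tau>'_def)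
  ultimately show ?thesis by (intro bexI) auto
qed

text \<open>Multiplication by the j-th coordinate, once the coordinate m is set to 1, on the dual of the
  coordinate ring of the locus where the first n + m - 1 columns drop rank.\<close>

definition shift :: "nat \<Rightarrow> (nat multiset \<Rightarrow> complex) \<Rightarrow> nat multiset \<Rightarrow> complex" where
  "shift j t = (SOME r. r \<in> minor_kernel (n + m - 1) \<and>
     (\<forall>M\<in>msets (Suc m) (n - 1). r (add_mset m M) = t (add_mset j M)))"

lemma shift:
  shows shift_in_kernel: "shift j t \<in> minor_kernel (n + m - 1)"
    and shift_add_mset: "M \<in> msets (Suc m) (n - 1) \<Longrightarrow> shift j t (add_mset m M) = t (add_mset j M)"
proof -
  have "\<exists>r. r \<in> minor_kernel (n + m - 1) \<and>
     (\<forall>M\<in>msets (Suc m) (n - 1). r (add_mset m M) = t (add_mset j M))"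
    using minor_kernel_extension[of "\<lambda>M. t (add_mset j M)"] by blast
  from someI_ex[OF this, folded shift_def] show "shift j t \<in> minor_kernel (n + m - 1)"
    "M \<in> msets (Suc m) (n - 1) \<Longrightarrow> shift j t (add_mset m M) = t (add_mset j M)" by auto
qed

lemma shift_last:
  assumes "t \<in> minor_kernel (n + m - 1)"
  shows "shift m t = t"
  by (rule minor_kernel_eqI) (use assms shift in auto)

lemma shift_linear:
  "shift j (\<lambda>M. x * t M + y * t' M) = (\<lambda>M. x * shift j t M + y * shift j t' M)"
proof (rule minor_kernel_eqI)
  show "(\<lambda>M. x * shift j t M + y * shift j t' M) \<in> minor_kernel (n + m - 1)"
    by (intro lin_subspaceD[OF lin_subspace_minor_kernel] shift_in_kernel)
qed (rule shift_in_kernel, simp add: shift_add_mset)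

lemma subsets_of_card_Diff:
  "K \<in> subsets_of_card c (Suc k) \<Longrightarrow> i \<in> K \<Longrightarrow> K - {i} \<in> subsets_of_card c k"
  by auto

text \<open>The key to commutativity: the tensors \<open>shift j t\<close> are contractions of a
  single tensor s of degree n + 1. On multisets containing m, s is forced by
  \<open>shift m t = t\<close>; the rest lives on B' and is assembled by
  \<open>wedge_exterior_minors_kernel\<close>.\<close>

lemma shift_lift:
  assumes t: "t \<in> minor_kernel (n + m - 1)"
  shows "\<exists>s. \<forall>j<Suc m. \<forall>M\<in>msets (Suc m) n. shift j t M = s (add_mset j M)"
proof -
  let ?E = "exterior_minor (Suc m) g [0..<n]"
  \<comment> \<open>The forced part of s, set to zero where m is absent; \<rho> is what it leaves
    over on B'.\<close>
  define \<tau> where "\<tau> N = (if m \<in># N then t (N - {#m#}) else 0)" for N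
  define \<rho> where "\<rho> j M = (if m \<in># M then 0 else shift j t M)" for j M
  have split: "shift j t M = \<tau> (add_mset j M) + (if j = m then 0 else \<rho> j M)"
    if jM: "j < Suc m" "M \<in> msets (Suc m) n" for j M
  proof -
    consider "j = m" | "j < m" "m \<in># M" | "j < m" "m \<notin># M" using jM(1) less_SucE by blast
    then show ?thesis
    proof cases
      case 2
      from msets_remove[OF jM(2) 2(2)] obtain M' where "M = add_mset m M'" "M' \<in> msets (Suc m) (n - 1)" .
      then show ?thesis using 2 by (simp add: shift_add_mset \<tau>_def \<rho>_def)
    qed (simp_all add: shift_last[OF t] \<tau>_def \<rho>_def)
  qed
  have "\<exists>\<tau>'. \<forall>j<m. \<forall>M\<in>msets m n. \<rho> j M = \<tau>' (add_mset j M)"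
  proof (rule wedge_exterior_minors_kernel)
    fix l K assume l: "l < n" and K: "K \<in> subsets_of_card (n + m - 1) (Suc n)"
    have "finite K" using K finite_subset by blast
    \<comment> \<open>Each K - {k} is an n-set where the minors of \<open>shift j t\<close> vanish,
      so the whole sum is zero. Its \<tau>-part is zero by a repeated row, and the relation for
      \<rho> remains.\<close>
    have "?E (shift j t) (K - {k}) = 0" if "k \<in> K" for j k
      using shift_in_kernel[of j t] subsets_of_card_Diff[OF K that] by (simp add: minor_kernel_def)
    then have "0 = (\<Sum>j<Suc m. wedge (g l j) (?E (shift j t)) K)" by (simp add: wedge_def)
    also have "\<dots> = (\<Sum>j<Suc m. wedge (g l j) (\<lambda>L. 1 * ?E (\<lambda>M. \<tau> (add_mset j M)) L
        + 1 * ?E (\<lambda>M. if j = m then 0 else \<rho> j M) L) K)"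
    proof (intro sum.cong refl wedge_cong)
      fix j k assume "j \<in> {..<Suc m}"
      then have "?E (shift j t) (K - {k}) = ?E (\<lambda>M. \<tau> (add_mset j M) + (if j = m then 0 else \<rho> j M)) (K - {k})"
        by (intro exterior_minor_cong split) auto
      then show "?E (shift j t) (K - {k}) = 1 * ?E (\<lambda>M. \<tau> (add_mset j M)) (K - {k})
        + 1 * ?E (\<lambda>M. if j = m then 0 else \<rho> j M) (K - {k})" by (simp only: exterior_minor_add mult_1)
    qed
    also have "\<dots> = exterior_minor (Suc m) g (l # [0..<n]) \<tau> K
        + (\<Sum>j<Suc m. wedge (g l j) (?E (\<lambda>M. if j = m then 0 else \<rho> j M)) K)"
      unfolding wedge_lin by (simp only: sum.distrib exterior_minor.simps mult_1)
    also have "exterior_minor (Suc m) g (l # [0..<n]) \<tau> K = 0"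
      by (rule exterior_minor_repeated_row) (use \<open>finite K\<close> l in auto)
    also have "(\<Sum>j<Suc m. wedge (g l j) (?E (\<lambda>M. if j = m then 0 else \<rho> j M)) K) =
        (\<Sum>j<m. wedge (g l j) (?E (\<rho> j)) K)"
    proof -
      have "?E (\<lambda>M. 0) = (\<lambda>_. 0)" by (rule ext) (rule exterior_minor_zero)
      then show ?thesis by simp
    qed
    also have "\<dots> = (\<Sum>j<m. wedge (g l j) (exterior_minor m g [0..<n] (\<rho> j)) K)"
      by (intro sum.cong refl wedge_cong exterior_minor_restrict) (simp add: \<rho>_def)
    finally show "(\<Sum>j<m. wedge (g l j) (exterior_minor m g [0..<n] (\<rho> j)) K) = 0" by simp
  qed
  then obtain \<tau>' where \<tau>': "\<And>j M. j < m \<Longrightarrow> M \<in> msets m n \<Longrightarrow> \<rho> j M = \<tau>' (add_mset j M)" by blast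
  define s where "s N = (if m \<in># N then t (N - {#m#}) else \<tau>' N)" for N
  have "shift j t M = s (add_mset j M)" if "j < Suc m" "M \<in> msets (Suc m) n" for j M
  proof (cases "m \<in># add_mset j M")
    case True
    then have "(if j = m then 0 else \<rho> j M) = 0" by (auto simp: \<rho>_def)
    with True show ?thesis unfolding split[OF that] by (simp only: s_def \<tau>_def if_True add_0_right)
  next
    case False
    then have "j < m" "M \<in> msets m n" using that msets_Suc_avoiding by auto
    then show ?thesis unfolding split[OF that] using False \<tau>' by (simp add: s_def \<tau>_def)
  qed
  then show ?thesis by blast
qed

text \<open>With s from \<open>shift_lift\<close>, both sides have the value s(i + j + M) at m +
  M.\<close>

lemma shift_commute:
  assumes "t \<in> minor_kernel (n + m - 1)" "i < Suc m" "j < Suc m"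
  shows "shift i (shift j t) = shift j (shift i t)"
proof (rule minor_kernel_eqI[OF shift_in_kernel shift_in_kernel])
  fix M assume M: "M \<in> msets (Suc m) (n - 1)"
  obtain s where "\<And>j M. j < Suc m \<Longrightarrow> M \<in> msets (Suc m) n \<Longrightarrow> shift j t M = s (add_mset j M)"
    using shift_lift[OF assms(1)] by blast
  then show "shift i (shift j t) (add_mset m M) = shift j (shift i t) (add_mset m M)"
    using M assms by (simp add: shift_add_mset add_mset_commute)
qed

text \<open>Only n-sets containing the new column n + m - 1 are in question. The minors y_j on them
  satisfy, for every row, the relation that s gives by a repeated row. Since y_m = 0, only m
  families are left, and \<open>wedge_rows_kernel_trivial\<close> makes them zero.\<close>

lemma shift_stable:
  assumes t: "t \<in> minor_kernel (n + m)" and j: "j < Suc m"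
  shows "shift j t \<in> minor_kernel (n + m)"
proof -
  let ?E = "exterior_minor (Suc m) g [0..<n]"
  let ?c = "n + m - 1"
  have Suc_c: "n + m = Suc ?c" using n_pos by simp
  have t': "t \<in> minor_kernel ?c" using t minor_kernel_mono by blast
  have E0: "?E (shift j t) K = 0" if "K \<in> subsets_of_card ?c n" for j K
    using shift_in_kernel[of j t] that by (simp add: minor_kernel_def)
  obtain s where s: "\<And>j M. j < Suc m \<Longrightarrow> M \<in> msets (Suc m) n \<Longrightarrow> shift j t M = s (add_mset j M)"
    using shift_lift[OF t'] by blast
  define y where "y j L = ?E (shift j t) (insert ?c L)" for j L
  have y0: "y j L = 0" if jL: "j < m" "L \<in> subsets_of_card ?c (n - 1)" for j L
  proof (rule wedge_rows_kernel_trivial[OF _ jL])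
    fix l K0 assume l: "l < n" and K0: "K0 \<in> subsets_of_card ?c n"
    define K where "K = insert ?c K0"
    have fin: "finite K0" "?c \<notin> K0" using K0 finite_subset by auto
    have K: "K \<in> subsets_of_card (n + m) (Suc n)" "finite K" using K0 fin Suc_c by (auto simp: K_def)
    have "wedge (g l j) (?E (shift j t)) K = wedge (g l j) (y j) K0" for j
    proof -
      \<comment> \<open>The term that removes the new column is a minor on old columns and
        vanishes.\<close>
      have "wedge (g l j) (?E (shift j t)) K = (\<Sum>k\<in>K0. pos_sign k K * g l j k * ?E (shift j t) (K - {k}))"
        unfolding wedge_def using fin E0[OF K0] by (simp add: K_def)
      also have "\<dots> = wedge (g l j) (y j) K0"
        unfolding wedge_def
      proof (intro sum.cong refl)
        fix k assume k: "k \<in> K0"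
        then have "k < ?c" using K0 by auto
        then have "pos_sign k K = pos_sign k K0" "K - {k} = insert ?c (K0 - {k})"
          using pos_sign_remove(2)[of K ?c k] K fin by (auto simp: K_def)
        then show "pos_sign k K * g l j k * ?E (shift j t) (K - {k}) = pos_sign k K0 * g l j k * y j (K0 - {k})"
          by (simp add: y_def)
      qed
      finally show ?thesis .
    qed
    then have "(\<Sum>j<Suc m. wedge (g l j) (y j) K0) = (\<Sum>j<Suc m. wedge (g l j) (?E (shift j t)) K)" by simp
    also have "\<dots> = exterior_minor (Suc m) g (l # [0..<n]) s K"
      unfolding exterior_minor.simps
      by (intro sum.cong refl wedge_cong exterior_minor_cong s) auto
    also have "\<dots> = 0"
      by (rule exterior_minor_repeated_row) (use K l in auto)
    finally have "(\<Sum>j<Suc m. wedge (g l j) (y j) K0) = 0" .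
    \<comment> \<open>Here t in the smaller kernel enters: the minors of
      \<open>shift m t = t\<close> vanish on sets with the new column as well.\<close>
    moreover have "wedge (g l m) (y m) K0 = 0"
    proof -
      have "y m (K0 - {k}) = 0" if "k \<in> K0" for k
      proof -
        have "insert ?c (K0 - {k}) \<in> subsets_of_card (n + m) n"
          using K0 that fin Suc_c card_Suc_Diff1[OF fin(1) that] by auto
        then show ?thesis using t by (simp add: y_def shift_last[OF t'] minor_kernel_def)
      qed
      then show ?thesis by (simp add: wedge_def)
    qed
    ultimately show "(\<Sum>j<m. wedge (g l j) (y j) K0) = 0" by simp
  qed
  show ?thesis
  proof (cases "j = m")
    case True
    then show ?thesis using t shift_last[OF t'] by simp
  next
    case False
    have "?E (shift j t) K = 0" if K: "K \<in> subsets_of_card (n + m) n" for K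
    proof (cases "?c \<in> K")
      case True
      have "finite K" using K finite_subset by blast
      moreover have "K - {?c} \<subseteq> {..<?c}" using K Suc_c by (auto simp: less_Suc_eq)
      ultimately have "K - {?c} \<in> subsets_of_card ?c (n - 1)" using K True by (simp add: card_Diff_singleton)
      then have "y j (K - {?c}) = 0" using y0 j False by simp
      then show ?thesis using True by (simp add: y_def insert_absorb)
    next
      case False
      have "K \<subseteq> {..<?c}"
      proof
        fix x assume "x \<in> K"
        then have "x < n + m" "x \<noteq> ?c" using K False by auto
        then show "x \<in> {..<?c}" by simp
      qed
      then show ?thesis using E0 K by simp
    qed
    then show ?thesis using shift_in_kernel[of j t] by (simp add: minor_kernel_def)
  qed
qed

text \<open>Each index j of N is traded for m at the price of a factor z j. Padding with copies of m
  keeps the size at n during the induction.\<close>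

lemma common_eigenvector_is_pure_power:
  assumes v: "\<And>j M. j < Suc m \<Longrightarrow> M \<in> msets (Suc m) (n - 1) \<Longrightarrow> v (add_mset j M) = z j * v (add_mset m M)"
    and "N \<in> msets (Suc m) k" "k \<le> n"
  shows "v (N + replicate_mset (n - k) m) = (\<Prod>j\<in>#N. z j) * v (replicate_mset n m)"
  using assms(2,3)
proof (induction k arbitrary: N)
  case 0
  then show ?case by simp
next
  case (Suc k)
  then have "size N = Suc k" by (simp add: multisets_of_size_def)
  then obtain j N' where N: "N = add_mset j N'" by (metis size_eq_Suc_imp_eq_union)
  with Suc.prems have j: "j < Suc m" "N' \<in> msets (Suc m) k" by auto
  let ?R = "replicate_mset (n - Suc k) m"
  have "N' + ?R \<in> msets (Suc m) (n - 1)" using j Suc.prems by (auto simp: multisets_of_size_def)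
  then have "v (N + ?R) = z j * v (add_mset m (N' + ?R))" using v[OF j(1)] by (simp add: N)
  also have "add_mset m (N' + ?R) = N' + replicate_mset (n - k) m"
    using Suc.prems by (simp add: Suc_diff_Suc[symmetric])
  finally show ?case using Suc.IH[OF j(2)] Suc.prems N by (simp add: mult.assoc)
qed

theorem independent_exterior_minors_Suc:
  assumes nd: "nondegenerate n (Suc m) (n + m) g"
    and \<tau>: "\<And>K. K \<in> subsets_of_card (n + m) n \<Longrightarrow> exterior_minor (Suc m) g [0..<n] \<tau> K = 0"
    and M: "M \<in> msets (Suc m) n"
  shows "\<tau> M = 0"
proof (rule ccontr)
  assume "\<tau> M \<noteq> 0"
  define t where "t N = (if N \<in> msets (Suc m) n then \<tau> N else 0)" for N
  have "exterior_minor (Suc m) g [0..<n] t K = exterior_minor (Suc m) g [0..<n] \<tau> K" for K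
    by (rule exterior_minor_cong) (simp add: t_def)
  then have t: "t \<in> minor_kernel (n + m)" using \<tau> by (simp add: minor_kernel_def t_def)
  have t0: "t \<noteq> (\<lambda>_. 0)" using M \<open>\<tau> M \<noteq> 0\<close> by (auto simp: t_def fun_eq_iff)
  have "\<exists>v\<in>minor_kernel (n + m). v \<noteq> (\<lambda>_. 0) \<and> (\<exists>z. \<forall>j<Suc m. shift j v = (\<lambda>i. z j * v i))"
  proof (rule commuting_lin_ops_common_eigenvector[OF lin_subspace_minor_kernel _ _ _ t t0])
    show "lin_op (minor_kernel (n + m)) (shift j)" if "j < Suc m" for j
      unfolding lin_op_def using shift_stable that shift_linear by blast
    show "finite (msets (Suc m) n)" by (simp add: finite_multisets_of_size)
    show "v i = 0" if "v \<in> minor_kernel (n + m)" "i \<notin> msets (Suc m) n" for v i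
      using that by (simp add: minor_kernel_def)
    show "shift i (shift j v) = shift j (shift i v)"
      if "i < Suc m" "j < Suc m" "v \<in> minor_kernel (n + m)" for i j v
      using shift_commute that minor_kernel_mono by blast
  qed
  then obtain v z where v: "v \<in> minor_kernel (n + m)" "v \<noteq> (\<lambda>_. 0)"
    and z: "\<And>j. j < Suc m \<Longrightarrow> shift j v = (\<lambda>i. z j * v i)" by blast
  obtain N0 where N0: "v N0 \<noteq> 0" using v(2) by (auto simp: fun_eq_iff)
  \<comment> \<open>The coordinate m acts as the identity, so z m = 1; this makes z a nonzero point
    of B.\<close>
  have "shift m v = v" using shift_last v(1) minor_kernel_mono by blast
  then have "v N0 = z m * v N0" using fun_cong[OF z[of m], of N0] by simp
  then have zm: "z m = 1" using N0 by simp
  define \<kappa> where "\<kappa> = v (replicate_mset n m)"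
  have eig: "v (add_mset j M) = z j * v (add_mset m M)" if "j < Suc m" "M \<in> msets (Suc m) (n - 1)" for j M
    using shift_add_mset[OF that(2), of j v] fun_cong[OF z[OF that(1)]] by simp
  have pure: "v N = (\<Prod>j\<in>#N. z j) * \<kappa>" if "N \<in> msets (Suc m) n" for N
    using common_eigenvector_is_pure_power[of v z, OF eig that] by (simp add: \<kappa>_def)
  have "N0 \<in> msets (Suc m) n" using N0 v(1) by (auto simp: minor_kernel_def)
  \<comment> \<open>With \<kappa> = 0 the eigenvector would vanish everywhere.\<close>
  then have \<kappa>: "\<kappa> \<noteq> 0" using N0 pure[of N0] by auto
  let ?f = "\<lambda>l k. \<Sum>j<Suc m. z j * g l j k"
  have minors: "detn n (\<lambda>s u. ?f s (sorted_list_of_set K ! u)) = 0" if K: "K \<in> subsets_of_card (n + m) n" for K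
  proof -
    have "finite K" using K finite_subset by blast
    have "0 = exterior_minor (Suc m) g [0..<n] v K" using v(1) K by (simp add: minor_kernel_def)
    also have "\<dots> = exterior_minor (Suc m) g [0..<n] (\<lambda>N. \<kappa> * (\<Prod>j\<in>#N. z j)) K"
      by (rule exterior_minor_cong) (simp add: pure mult.commute)
    also have "\<dots> = \<kappa> * foldr wedge (map ?f [0..<n]) (\<lambda>_. 1) K"
      by (simp add: exterior_minor_scale exterior_minor_pure_power)
    also have "foldr wedge (map ?f [0..<n]) (\<lambda>_. 1) K = detn n (\<lambda>s u. (map ?f [0..<n] ! s) (sorted_list_of_set K ! u))"
      using foldr_wedge_eq_detn[OF \<open>finite K\<close>, of "map ?f [0..<n]"] K by simp
    also have "\<dots> = detn n (\<lambda>s u. ?f s (sorted_list_of_set K ! u))"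
      by (rule detn_cong) simp
    finally show ?thesis using \<kappa> by simp
  qed
  have "\<exists>u. (\<exists>l<n. u l \<noteq> 0) \<and> (\<forall>k<n + m. (\<Sum>l<n. u l * ?f l k) = 0)"
  proof (rule rows_dependent_if_minors_vanish)
    fix \<kappa> assume "\<And>u. u < n \<Longrightarrow> \<kappa> u < n + m"
    then show "detn n (\<lambda>s u. ?f s (\<kappa> u)) = 0"
      \<comment> \<open>A single determinant is treated as a sum over a one-point set.\<close>
      using sum_detn_zero_all_columns[of "n + m" n "\<lambda>_. 1" "\<lambda>_. ?f" "{()}" \<kappa>] minors by simp
  qed
  then obtain u where u: "\<exists>l<n. u l \<noteq> 0" "\<And>k. k < n + m \<Longrightarrow> (\<Sum>l<n. u l * ?f l k) = 0" by blast
  have "(\<Sum>l<n. \<Sum>j<Suc m. u l * z j * g l j k) = 0" if "k < n + m" for k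
    using u(2)[OF that] by (simp only: sum_distrib_left mult.assoc)
  then have "(\<forall>l<n. u l = 0) \<or> (\<forall>j<Suc m. z j = 0)" using nd unfolding nondegenerate_def by blast
  then show False using u(1) zm by auto
qed

end

section \<open>Projection to the critical dimension\<close>

lemma digits_unique:
  fixes a a' :: "nat \<Rightarrow> nat"
  assumes "\<And>k. k < N \<Longrightarrow> a k < B" "\<And>k. k < N \<Longrightarrow> a' k < B"
    and "(\<Sum>k<N. a k * B ^ k) = (\<Sum>k<N. a' k * B ^ k)" "k < N"
  shows "a k = a' k"
  using assms
proof (induction N arbitrary: a a' k)
  case 0
  then show ?case by simp
next
  case (Suc N)
  have eq: "a 0 + B * (\<Sum>k<N. a (Suc k) * B ^ k) = a' 0 + B * (\<Sum>k<N. a' (Suc k) * B ^ k)"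
    using Suc.prems(3) unfolding sum.lessThan_Suc_shift by (simp add: sum_distrib_left mult_ac)
  have B: "a 0 < B" "a' 0 < B" using Suc.prems by auto
  have "(a 0 + B * (\<Sum>k<N. a (Suc k) * B ^ k)) mod B = a 0"
    "(a' 0 + B * (\<Sum>k<N. a' (Suc k) * B ^ k)) mod B = a' 0"
    using B by simp_all
  with eq have 0: "a 0 = a' 0" by simp
  with eq B have "(\<Sum>k<N. a (Suc k) * B ^ k) = (\<Sum>k<N. a' (Suc k) * B ^ k)" by simp
  then have "a (Suc k) = a' (Suc k)" if "k < N" for k
    using Suc.IH[of "\<lambda>k. a (Suc k)" "\<lambda>k. a' (Suc k)" k] Suc.prems that by auto
  with 0 show ?case using Suc.prems(4) by (cases k) auto
qed

lemma sum_mset_eq_sum_count: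
  fixes M :: "nat multiset"
  assumes "set_mset M \<subseteq> {..<N}"
  shows "(\<Sum>k\<in>#M. f k) = (\<Sum>k<N. count M k * (f k :: nat))"
  using assms
proof (induction M)
  case (add x M)
  have "(\<Sum>k<N. count (add_mset x M) k * f k) = (\<Sum>k<N. count M k * f k + (if k = x then f k else 0))"
    by (intro sum.cong) auto
  also have "\<dots> = (\<Sum>k<N. count M k * f k) + f x" using add by (simp add: sum.distrib)
  finally show ?case using add by simp
qed simp

text \<open>Multiplicities in a multiset of size d are at most d, so they are the digits of this sum
  in base d + 1.\<close>

lemma inj_on_digit_sum: "inj_on (\<lambda>M. \<Sum>k\<in>#M. Suc d ^ k) (msets N d)"
proof (rule inj_onI)
  fix M M' assume M: "M \<in> msets N d" "M' \<in> msets N d"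
    and eq: "(\<Sum>k\<in>#M. Suc d ^ k) = (\<Sum>k\<in>#M'. Suc d ^ k)"
  have sub: "set_mset M \<subseteq> {..<N}" "set_mset M' \<subseteq> {..<N}" "size M = d" "size M' = d"
    using M by (auto simp: multisets_of_size_def)
  show "M = M'"
  proof (rule multiset_eqI)
    fix k
    show "count M k = count M' k"
    proof (cases "k < N")
      case True
      have "count M k < Suc d" "count M' k < Suc d" for k
        using sub count_le_size[of M k] count_le_size[of M' k] by auto
      then show ?thesis
        using digits_unique[of N "count M" "Suc d" "count M'" k] eq True sub
        by (simp add: sum_mset_eq_sum_count del: power_Suc)
    next
      case False
      then show ?thesis using sub by (metis count_inI lessThan_iff subsetD)
    qed
  qed
qed

text \<open>The substitution w k = y^((d + 1)^k) turns distinct monomials of degree d into distinct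
  powers of y, and a polynomial in one variable without nonzero values is zero.\<close>

lemma vanishing_form_coeffs_zero:
  assumes "\<And>w :: nat \<Rightarrow> complex. (\<Sum>M\<in>msets N d. x M * (\<Prod>k\<in>#M. w k)) = 0" and "M0 \<in> msets N d"
  shows "x M0 = 0"
proof -
  have fin: "finite (msets N d)" by (simp add: finite_multisets_of_size)
  define e where "e M = (\<Sum>k\<in>#M. Suc d ^ k)" for M :: "nat multiset"
  define p where "p = (\<Sum>M\<in>msets N d. monom (x M) (e M))"
  have "poly p y = 0" for y
  proof -
    have "(\<Prod>k\<in>#M. y ^ (Suc d ^ k)) = y ^ e M" for M :: "nat multiset"
      by (induction M) (simp_all add: e_def power_add)
    then show ?thesis using assms(1)[of "\<lambda>k. y ^ (Suc d ^ k)"]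
      by (simp add: p_def poly_sum poly_monom)
  qed
  then have "p = 0" using poly_all_0_iff_0 by blast
  then have "0 = coeff p (e M0)" by simp
  also have "\<dots> = (\<Sum>M\<in>msets N d. if M = M0 then x M else 0)"
    unfolding p_def coeff_sum coeff_monom
    using inj_on_digit_sum[of d N] assms(2)
    by (intro sum.cong refl if_cong) (auto simp: inj_on_def e_def)
  also have "\<dots> = x M0" using assms(2) fin by simp
  finally show ?thesis by simp
qed

text \<open>A monomial of degree d pulls back along a bilinear map to a form of bidegree (d, d). The
  dimension count needs only coefficients that do not depend on u and \<beta>.\<close>

lemma bilinear_monomial_expand:
  fixes g :: "nat \<Rightarrow> nat \<Rightarrow> nat \<Rightarrow> complex"
  shows "\<exists>C. \<forall>u \<beta>. (\<Prod>k\<in>#M. \<Sum>l<n. \<Sum>j<m. u l * \<beta> j * g l j k) =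
    (\<Sum>(P, Q)\<in>msets n (size M) \<times> msets m (size M). C (P, Q) * ((\<Prod>l\<in>#P. u l) * (\<Prod>j\<in>#Q. \<beta> j)))"
proof (induction M)
  case empty
  show ?case by (intro exI[of _ "\<lambda>_. 1"]) simp
next
  case (add k M)
  let ?X = "msets n (size M) \<times> msets m (size M)"
  let ?Y = "msets n (Suc (size M)) \<times> msets m (Suc (size M))"
  have fin: "finite (msets i j)" for i j by (simp add: finite_multisets_of_size)
  let ?mono = "\<lambda>u \<beta> (P, Q). (\<Prod>l\<in>#P. u l) * (\<Prod>j\<in>#Q. \<beta> j) :: complex"
  from add obtain C where C: "\<And>u \<beta>. (\<Prod>k\<in>#M. \<Sum>l<n. \<Sum>j<m. u l * \<beta> j * g l j k) = (\<Sum>y\<in>?X. C y * ?mono u \<beta> y)"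
    by (auto simp: case_prod_beta)
  define S where "S = ({..<n} \<times> {..<m}) \<times> ?X"
  define F where "F = (\<lambda>((l, j), (P, Q)). (add_mset l P :: nat multiset, add_mset j Q :: nat multiset))"
  define a where "a = (\<lambda>((l, j), y). g l j k * C y)"
  \<comment> \<open>Several terms can give the same pair of monomials; C' adds their coefficients
    over each fibre of F.\<close>
  define C' where "C' y = (\<Sum>s\<in>{s\<in>S. F s = y}. a s)" for y
  have "(\<Prod>k\<in>#add_mset k M. \<Sum>l<n. \<Sum>j<m. u l * \<beta> j * g l j k) = (\<Sum>y\<in>?Y. C' y * ?mono u \<beta> y)" for u \<beta>
  proof -
    have "(\<Prod>k\<in>#add_mset k M. \<Sum>l<n. \<Sum>j<m. u l * \<beta> j * g l j k) =
        (\<Sum>lj\<in>{..<n} \<times> {..<m}. u (fst lj) * \<beta> (snd lj) * g (fst lj) (snd lj) k) * (\<Sum>y\<in>?X. C y * ?mono u \<beta> y)"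
      by (simp only: image_mset_add_mset prod_mset.add_mset C) (simp add: sum.cartesian_product case_prod_beta)
    also have "\<dots> = (\<Sum>s\<in>S. (u (fst (fst s)) * \<beta> (snd (fst s)) * g (fst (fst s)) (snd (fst s)) k) * (C (snd s) * ?mono u \<beta> (snd s)))"
      unfolding S_def sum_product by (simp add: sum.cartesian_product case_prod_beta)
    also have "\<dots> = (\<Sum>s\<in>S. a s * ?mono u \<beta> (F s))"
      by (intro sum.cong refl) (auto simp: a_def F_def mult_ac)
    also have "\<dots> = (\<Sum>y\<in>?Y. \<Sum>s\<in>{s\<in>S. F s = y}. a s * ?mono u \<beta> (F s))"
      by (rule sum.group[symmetric]) (auto simp: S_def F_def fin)
    also have "\<dots> = (\<Sum>y\<in>?Y. C' y * ?mono u \<beta> y)"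
      unfolding C'_def sum_distrib_right by (intro sum.cong refl) auto
    finally show ?thesis .
  qed
  then show ?case by (intro exI[of _ C']) (auto simp: case_prod_beta)
qed

text \<open>As polynomials in d the left side has degree n + m - 2, the right side degree n + m -
  1.\<close>

lemma binomial_growth:
  assumes "0 < n" "0 < m"
  shows "\<exists>d. (n + d - 1 choose d) * (m + d - 1 choose d) < (n + m + d - 1 choose d)"
proof -
  define r where "r = n + m - 1"
  have r: "r > 0" using assms by (simp add: r_def)
  \<comment> \<open>The left side is at most D^(r - 1), the right side at least (D / r)^r, so D >
    r^r is enough.\<close>
  define d where "d = r ^ r"
  define D where "D = d + r"
  have le: "(i + d - 1 choose d) \<le> D ^ (i - 1)" if "0 < i" "i \<le> n + m" for i
  proof -
    have "(i + d - 1 choose d) = (i + d - 1 choose (i - 1))"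
      using binomial_symmetric[of d "i + d - 1"] that by simp
    also have "\<dots> \<le> (i + d - 1) ^ (i - 1)"
      using that by (intro binomial_le_pow) simp
    also have "\<dots> \<le> D ^ (i - 1)" using that by (intro power_mono) (auto simp: D_def r_def)
    finally show ?thesis .
  qed
  have "(n + d - 1 choose d) * (m + d - 1 choose d) \<le> D ^ (n - 1) * D ^ (m - 1)"
    using assms by (intro mult_le_mono le) auto
  also have "\<dots> = D ^ (r - 1)" using assms by (simp add: r_def power_add[symmetric])
  finally have 1: "real ((n + d - 1 choose d) * (m + d - 1 choose d)) \<le> real D ^ (r - 1)"
    by (metis of_nat_le_iff of_nat_power)
  have "real D ^ (r - 1) * real (r ^ r) < real D ^ (r - 1) * real D"
    using r by (intro mult_strict_left_mono zero_less_power) (auto simp: D_def d_def add_nonneg_pos)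
  also have "\<dots> = real D ^ r" using r by (rule power_minus_mult)
  finally have "real D ^ (r - 1) < (real D / real r) ^ r"
    using r by (simp add: power_divide pos_less_divide_eq)
  also have "\<dots> \<le> real (D choose r)"
    by (rule binomial_ge_n_over_k_pow_k) (simp add: D_def)
  also have "D choose r = n + m + d - 1 choose d"
    using binomial_symmetric[of d D] assms by (simp add: D_def r_def add.commute)
  finally show ?thesis using 1 by (intro exI[of _ d]) linarith
qed

text \<open>The forms of degree d in n + m variables outnumber the bihomogeneous forms of bidegree (d, d)
  in n and m variables, so some form vanishes on the image.\<close>

lemma bilinear_map_not_surjective:
  fixes g :: "nat \<Rightarrow> nat \<Rightarrow> nat \<Rightarrow> complex"
  assumes "0 < n" "n + m \<le> c"
  shows "\<exists>w. \<forall>u \<beta>. \<exists>k<c. (\<Sum>l<n. \<Sum>j<m. u l * \<beta> j * g l j k) \<noteq> w k"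
proof (cases "m = 0")
  case True
  then show ?thesis using assms by (intro exI[of _ "\<lambda>_. 1"] allI exI[of _ 0]) auto
next
  case False
  have fin: "finite (msets i j)" for i j by (simp add: finite_multisets_of_size)
  show ?thesis
  proof (rule ccontr)
    assume "\<nexists>w. \<forall>u \<beta>. \<exists>k<c. (\<Sum>l<n. \<Sum>j<m. u l * \<beta> j * g l j k) \<noteq> w k"
    then have surj: "\<exists>u \<beta>. \<forall>k<c. (\<Sum>l<n. \<Sum>j<m. u l * \<beta> j * g l j k) = w k" for w by blast
    obtain d where d: "(n + d - 1 choose d) * (m + d - 1 choose d) < (n + m + d - 1 choose d)"
      using binomial_growth assms False by blast
    have "\<forall>M. \<exists>C. \<forall>u \<beta>. (\<Prod>k\<in>#M. \<Sum>l<n. \<Sum>j<m. u l * \<beta> j * g l j k) =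
      (\<Sum>(P, Q)\<in>msets n (size M) \<times> msets m (size M). C (P, Q) * ((\<Prod>l\<in>#P. u l) * (\<Prod>j\<in>#Q. \<beta> j)))"
      using bilinear_monomial_expand by blast
    from choice[OF this] obtain C where C: "\<forall>M u \<beta>. (\<Prod>k\<in>#M. \<Sum>l<n. \<Sum>j<m. u l * \<beta> j * g l j k) =
      (\<Sum>(P, Q)\<in>msets n (size M) \<times> msets m (size M). C M (P, Q) * ((\<Prod>l\<in>#P. u l) * (\<Prod>j\<in>#Q. \<beta> j)))"
      by (rule exE)
    let ?I = "msets (n + m) d" and ?J = "msets n d \<times> msets m d"
    have "card ?J < card ?I" using d by (simp add: card_cartesian_product card_multisets_of_size)
    \<comment> \<open>The coefficients of a nonzero form whose pullback vanishes
      identically.\<close>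
    then obtain x where x: "\<exists>M\<in>?I. x M \<noteq> 0" "\<And>y. y \<in> ?J \<Longrightarrow> (\<Sum>M\<in>?I. C M y * x M) = 0"
      using underdetermined_system_nontrivial_solution[of ?J ?I "\<lambda>y M. C M y"] fin by blast
    have "(\<Sum>M\<in>?I. x M * (\<Prod>k\<in>#M. w k)) = 0" for w
    proof -
      obtain u \<beta> where ub: "\<And>k. k < c \<Longrightarrow> (\<Sum>l<n. \<Sum>j<m. u l * \<beta> j * g l j k) = w k" using surj by blast
      have "(\<Prod>k\<in>#M. w k) = (\<Sum>y\<in>?J. C M y * ((\<Prod>l\<in>#fst y. u l) * (\<Prod>j\<in>#snd y. \<beta> j)))" if "M \<in> ?I" for M
      proof -
        have M: "size M = d" "\<And>k. k \<in># M \<Longrightarrow> k < c"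
          using that assms by (fastforce simp: multisets_of_size_def)+
        have "(\<Prod>k\<in>#M. w k) = (\<Prod>k\<in>#M. \<Sum>l<n. \<Sum>j<m. u l * \<beta> j * g l j k)"
          by (intro arg_cong[of _ _ prod_mset] image_mset_cong) (simp add: ub M)
        then show ?thesis unfolding C[rule_format] M by (simp add: case_prod_beta)
      qed
      then have "(\<Sum>M\<in>?I. x M * (\<Prod>k\<in>#M. w k)) =
          (\<Sum>M\<in>?I. \<Sum>y\<in>?J. (C M y * x M) * ((\<Prod>l\<in>#fst y. u l) * (\<Prod>j\<in>#snd y. \<beta> j)))"
        by (simp add: sum_distrib_left mult_ac)
      also have "\<dots> = (\<Sum>y\<in>?J. (\<Sum>M\<in>?I. C M y * x M) * ((\<Prod>l\<in>#fst y. u l) * (\<Prod>j\<in>#snd y. \<beta> j)))"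
        by (subst sum.swap) (simp add: sum_distrib_right)
      also have "\<dots> = 0" using x(2) by (intro sum.neutral) simp
      finally show ?thesis .
    qed
    then show False using vanishing_form_coeffs_zero x(1) by blast
  qed
qed

section \<open>Linear maps of C and projections\<close>

lemma detn_column_combinations:
  fixes v \<phi> :: "nat \<Rightarrow> nat \<Rightarrow> complex"
  shows "detn n (\<lambda>s u. \<Sum>k<c. \<phi> u k * v s k) =
    (\<Sum>\<kappa>\<in>PiE {..<n} (\<lambda>_. {..<c}). (\<Prod>u<n. \<phi> u (\<kappa> u)) * detn n (\<lambda>s u. v s (\<kappa> u)))"
proof -
  have T: "detn n M = (\<Sum>\<sigma> | \<sigma> permutes {..<n}. of_int (sign \<sigma>) * (\<Prod>t<n. M (\<sigma> t) t))" for M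
    using detn_transpose[of n M] by (simp add: detn_def)
  have "detn n (\<lambda>s u. \<Sum>k<c. \<phi> u k * v s k) =
      (\<Sum>\<sigma> | \<sigma> permutes {..<n}. of_int (sign \<sigma>) *
        (\<Sum>\<kappa>\<in>PiE {..<n} (\<lambda>_. {..<c}). \<Prod>t<n. \<phi> t (\<kappa> t) * v (\<sigma> t) (\<kappa> t)))"
    unfolding T by (subst prod_sum_PiE) auto
  also have "\<dots> = (\<Sum>\<sigma> | \<sigma> permutes {..<n}. \<Sum>\<kappa>\<in>PiE {..<n} (\<lambda>_. {..<c}).
      (\<Prod>t<n. \<phi> t (\<kappa> t)) * (of_int (sign \<sigma>) * (\<Prod>t<n. v (\<sigma> t) (\<kappa> t))))"
    by (simp add: sum_distrib_left prod.distrib mult_ac)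
  also have "\<dots> = (\<Sum>\<kappa>\<in>PiE {..<n} (\<lambda>_. {..<c}). (\<Prod>t<n. \<phi> t (\<kappa> t)) * detn n (\<lambda>s u. v s (\<kappa> u)))"
    unfolding T by (subst sum.swap) (simp add: sum_distrib_left)
  finally show ?thesis .
qed

text \<open>By multilinearity in the columns the new minors are combinations of minors of g. K may
  lie anywhere, so enlarging C is covered as well as projecting it.\<close>

lemma exterior_minor_zero_coordinate_change:
  assumes "\<And>K. K \<in> subsets_of_card c n \<Longrightarrow> exterior_minor b g [0..<n] \<tau> K = 0"
    and g': "\<And>l j k. g' l j k = (\<Sum>k'<c. P k k' * g l j k')"
    and K: "finite K" "card K = n"
  shows "exterior_minor b g' [0..<n] \<tau> K = 0"
proof -
  have vanish: "(\<Sum>js\<in>idx_lists b n. \<tau> (mset js) * detn n (\<lambda>s u. g s (js ! s) (\<kappa> u))) = 0"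
    if "\<kappa> \<in> PiE {..<n} (\<lambda>_. {..<c})" for \<kappa>
  proof (rule sum_detn_zero_all_columns[of c n _ "\<lambda>js s. g s (js ! s)"])
    fix L assume L: "L \<in> subsets_of_card c n"
    then have "finite L" using finite_subset by blast
    then show "(\<Sum>js\<in>idx_lists b n. \<tau> (mset js) * detn n (\<lambda>s u. g s (js ! s) (sorted_list_of_set L ! u))) = 0"
      using assms(1)[OF L] exterior_minor_eq_sum_detn[of L n b g \<tau>] L by simp
  qed (use that in auto)
  let ?\<phi> = "\<lambda>u. P (sorted_list_of_set K ! u)"
  have "exterior_minor b g' [0..<n] \<tau> K = (\<Sum>js\<in>idx_lists b n. \<Sum>\<kappa>\<in>PiE {..<n} (\<lambda>_. {..<c}).
      (\<Prod>u<n. ?\<phi> u (\<kappa> u)) * (\<tau> (mset js) * detn n (\<lambda>s u. g s (js ! s) (\<kappa> u))))"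
    unfolding exterior_minor_eq_sum_detn[OF K] g' detn_column_combinations
    by (simp add: sum_distrib_left mult_ac)
  also have "\<dots> = (\<Sum>\<kappa>\<in>PiE {..<n} (\<lambda>_. {..<c}). (\<Prod>u<n. ?\<phi> u (\<kappa> u)) *
      (\<Sum>js\<in>idx_lists b n. \<tau> (mset js) * detn n (\<lambda>s u. g s (js ! s) (\<kappa> u))))"
    by (subst sum.swap) (simp add: sum_distrib_left)
  also have "\<dots> = 0" using vanish by (intro sum.neutral) simp
  finally show ?thesis .
qed

lemma nondegenerate_mono:
  assumes "nondegenerate n b c g" "m \<le> b"
  shows "nondegenerate n m c g"
  unfolding nondegenerate_def
proof (intro allI impI)
  fix u \<beta> assume 0: "\<forall>k<c. (\<Sum>l<n. \<Sum>j<m. u l * \<beta> j * g l j k) = 0"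
  define \<beta>' where "\<beta>' j = (if j < m then \<beta> j else 0)" for j
  have "(\<Sum>j<b. u l * \<beta>' j * g l j k) = (\<Sum>j<m. u l * \<beta> j * g l j k)" for l k
    using assms(2) by (intro sum.mono_neutral_cong_right) (auto simp: \<beta>'_def)
  then have "\<forall>k<c. (\<Sum>l<n. \<Sum>j<b. u l * \<beta>' j * g l j k) = 0" using 0 by simp
  then have "(\<forall>l<n. u l = 0) \<or> (\<forall>j<b. \<beta>' j = 0)" using assms(1) unfolding nondegenerate_def by blast
  then show "(\<forall>l<n. u l = 0) \<or> (\<forall>j<m. \<beta> j = 0)" using assms(2) by (auto simp: \<beta>'_def split: if_splits)
qed

text \<open>Project from a point outside the image of the bilinear map, after moving it to the last basis vector.\<close>

lemma nondegenerate_projection: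
  assumes w: "\<And>u \<beta>. \<exists>k<c. (\<Sum>l<n. \<Sum>j<m. u l * \<beta> j * g l j k) \<noteq> w k"
    and nd: "nondegenerate n b c g" and "m \<le> b"
  shows "\<exists>g' P. (\<forall>l j k. g' l j k = (\<Sum>k'<c. P k k' * g l j k')) \<and>
    nondegenerate n b c g' \<and> nondegenerate n m (c - 1) g'"
proof -
  obtain k0 where k0: "k0 < c" "w k0 \<noteq> 0" using w[of "\<lambda>_. 0" "\<lambda>_. 0"] by auto
  define \<pi> where "\<pi> = Transposition.transpose k0 (c - 1)"
  have \<pi>: "\<pi> k < c" if "k < c" for k using that k0 by (auto simp: \<pi>_def Transposition.transpose_def)
  have \<pi>0: "\<pi> (\<pi> k) = k" "\<pi> (c - 1) = k0" for k by (simp_all add: \<pi>_def)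
  \<comment> \<open>Coordinate k0 moves to the last place, and from each other coordinate the
    multiple of it that kills w is subtracted. So w becomes a multiple of the last basis
    vector.\<close>
  define P where "P k k' = (if k = c - 1 then if k' = k0 then 1 else 0
     else (if k' = \<pi> k then 1 else 0) - w (\<pi> k) / w k0 * (if k' = k0 then 1 else 0))" for k k'
  define g' where "g' l j k = (\<Sum>k'<c. P k k' * g l j k')" for l j k
  define \<Gamma> where "\<Gamma> b' u \<beta> k = (\<Sum>l<n. \<Sum>j<b'. u l * \<beta> j * g l j k)" for b' :: nat and u \<beta> :: "nat \<Rightarrow> complex" and k
  have P: "(\<Sum>k'<c. P k k' * z k') = (if k = c - 1 then z k0 else z (\<pi> k) - w (\<pi> k) / w k0 * z k0)"
    if "k < c" for k and z :: "nat \<Rightarrow> complex"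
  proof -
    have "(\<Sum>k'<c. P k k' * z k') = (\<Sum>k'<c. (if k = c - 1 then if k' = k0 then z k' else 0
       else (if k' = \<pi> k then z k' else 0) - (if k' = k0 then w (\<pi> k) / w k0 * z k' else 0)))"
      by (intro sum.cong refl) (simp add: P_def)
    also have "\<dots> = (if k = c - 1 then z k0 else z (\<pi> k) - w (\<pi> k) / w k0 * z k0)"
      using k0 \<pi>[OF that] by (auto simp: sum_subtractf)
    finally show ?thesis .
  qed
  have G: "(\<Sum>l<n. \<Sum>j<b'. u l * \<beta> j * g' l j k) =
      (if k = c - 1 then \<Gamma> b' u \<beta> k0 else \<Gamma> b' u \<beta> (\<pi> k) - w (\<pi> k) / w k0 * \<Gamma> b' u \<beta> k0)"
    if "k < c" for b' u \<beta> k
  proof -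
    have "(\<Sum>l<n. \<Sum>j<b'. u l * \<beta> j * g' l j k) = (\<Sum>l<n. \<Sum>j<b'. \<Sum>k'<c. P k k' * (u l * \<beta> j * g l j k'))"
      by (simp add: g'_def sum_distrib_left mult_ac)
    also have "\<dots> = (\<Sum>l<n. \<Sum>k'<c. \<Sum>j<b'. P k k' * (u l * \<beta> j * g l j k'))"
      by (intro sum.cong refl sum.swap)
    also have "\<dots> = (\<Sum>k'<c. P k k' * \<Gamma> b' u \<beta> k')"
      unfolding \<Gamma>_def sum_distrib_left by (rule sum.swap)
    finally show ?thesis using P[OF that] by simp
  qed
  have 1: "nondegenerate n b c g'"
    unfolding nondegenerate_def
  proof (intro allI impI)
    fix u \<beta> assume 0: "\<forall>k<c. (\<Sum>l<n. \<Sum>j<b. u l * \<beta> j * g' l j k) = 0"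
    have c1: "c - 1 < c" using k0 by simp
    from 0[rule_format, OF c1] have z0: "\<Gamma> b u \<beta> k0 = 0" unfolding G[OF c1] by simp
    have "\<Gamma> b u \<beta> k = 0" if "k < c" for k
    proof (cases "k = k0")
      case False
      then have "\<pi> k \<noteq> c - 1" using \<pi>0 by metis
      then show ?thesis using 0[rule_format, OF \<pi>[OF that]] unfolding G[OF \<pi>[OF that]] by (simp add: z0 \<pi>0)
    qed (use z0 in simp)
    then show "(\<forall>l<n. u l = 0) \<or> (\<forall>j<b. \<beta> j = 0)" using nd unfolding nondegenerate_def \<Gamma>_def by blast
  qed
  have 2: "nondegenerate n m (c - 1) g'"
    unfolding nondegenerate_def
  proof (intro allI impI)
    fix u \<beta> assume 0: "\<forall>k<c - 1. (\<Sum>l<n. \<Sum>j<m. u l * \<beta> j * g' l j k) = 0"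
    \<comment> \<open>A product whose projection vanishes equals q w; for nonzero q, rescaling u
      would put w into the image.\<close>
    define q where "q = \<Gamma> m u \<beta> k0 / w k0"
    have q: "\<Gamma> m u \<beta> k = q * w k" if "k < c" for k
    proof (cases "k = k0")
      case True
      then show ?thesis using k0 by (simp add: q_def)
    next
      case False
      then have "\<pi> k \<noteq> c - 1" using \<pi>0 by metis
      then have "\<pi> k < c - 1" using \<pi>[OF that] by simp
      from 0[rule_format, OF this] show ?thesis
        unfolding G[OF \<pi>[OF that]] using \<open>\<pi> k \<noteq> c - 1\<close> by (simp add: q_def \<pi>0)
    qed
    have "q = 0"
    proof (rule ccontr)
      assume "q \<noteq> 0"
      have "(\<Sum>l<n. \<Sum>j<m. (u l / q) * \<beta> j * g l j k) = w k" if "k < c" for k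
      proof -
        have "(\<Sum>l<n. \<Sum>j<m. (u l / q) * \<beta> j * g l j k) = \<Gamma> m u \<beta> k / q"
          by (simp add: \<Gamma>_def sum_divide_distrib)
        then show ?thesis using q[OF that] \<open>q \<noteq> 0\<close> by simp
      qed
      then show False using w[of "\<lambda>l. u l / q" \<beta>] by blast
    qed
    then have "\<forall>k<c. (\<Sum>l<n. \<Sum>j<m. u l * \<beta> j * g l j k) = 0" using q by (simp add: \<Gamma>_def)
    then show "(\<forall>l<n. u l = 0) \<or> (\<forall>j<m. \<beta> j = 0)"
      using nondegenerate_mono[OF nd \<open>m \<le> b\<close>] unfolding nondegenerate_def by blast
  qed
  show ?thesis using 1 2 g'_def by blast
qed

lemma exterior_minors_independent_critical:
  assumes "0 < n" "nondegenerate n b (n + b - 1) g"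
    and "\<And>K. K \<in> subsets_of_card (n + b - 1) n \<Longrightarrow> exterior_minor b g [0..<n] \<tau> K = 0"
    and "M \<in> msets b n"
  shows "\<tau> M = 0"
  using assms(2-4)
proof (induction b arbitrary: g \<tau> M)
  case 0
  then show ?case using assms(1) by auto
next
  case (Suc m)
  have c: "n + Suc m - 1 = n + m" by simp
  \<comment> \<open>Only the image of U x B' must miss w, and n + m coordinates leave room for that.
    On all of B the last coordinate is kept.\<close>
  obtain w where w: "\<And>u \<beta>. \<exists>k<n + m. (\<Sum>l<n. \<Sum>j<m. u l * \<beta> j * g l j k) \<noteq> w k"
    using bilinear_map_not_surjective[OF assms(1), of m "n + m" g] by auto
  obtain g' P where g': "\<And>l j k. g' l j k = (\<Sum>k'<n + m. P k k' * g l j k')"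
    and nd: "nondegenerate n (Suc m) (n + m) g'" "nondegenerate n m (n + m - 1) g'"
    using nondegenerate_projection[OF w, of "Suc m"] Suc.prems(1) unfolding c by auto
  interpret independent_exterior_minors n m g'
  proof
    fix \<tau> assume "\<And>K. K \<in> subsets_of_card (n + m - 1) n \<Longrightarrow> exterior_minor m g' [0..<n] \<tau> K = 0"
    then show "\<forall>M\<in>msets m n. \<tau> M = 0" using Suc.IH[OF nd(2), of \<tau>] by blast
  qed (rule assms(1))
  show ?case
  proof (rule independent_exterior_minors_Suc[OF nd(1) _ Suc.prems(3)])
    fix K assume K: "K \<in> subsets_of_card (n + m) n"
    then have "finite K" using finite_subset by blast
    show "exterior_minor (Suc m) g' [0..<n] \<tau> K = 0"
      by (rule exterior_minor_zero_coordinate_change[OF Suc.prems(2) g'[folded c]]) (use K \<open>finite K\<close> in auto)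
  qed
qed

text \<open>Above the critical dimension even the image of all of U x B misses a vector; projecting
  from it keeps nondegeneracy and lowers i.\<close>

lemma exterior_minors_independent_above_critical:
  assumes "0 < n" "nondegenerate n b (n + b - 1 + i) g"
    and "\<And>K. K \<in> subsets_of_card (n + b - 1 + i) n \<Longrightarrow> exterior_minor b g [0..<n] \<tau> K = 0"
    and "M \<in> msets b n"
  shows "\<tau> M = 0"
  using assms(2,3)
proof (induction i arbitrary: g)
  case 0
  then show ?case using exterior_minors_independent_critical[OF assms(1)] assms(4) by simp
next
  case (Suc i)
  let ?c = "n + b - 1 + Suc i"
  have "n + b \<le> ?c" by linarith
  from bilinear_map_not_surjective[OF assms(1) this, of g] obtain w
    where w: "\<And>u \<beta>. \<exists>k<?c. (\<Sum>l<n. \<Sum>j<b. u l * \<beta> j * g l j k) \<noteq> w k" by blast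
  obtain g' P where g': "\<And>l j k. g' l j k = (\<Sum>k'<?c. P k k' * g l j k')"
    and nd: "nondegenerate n b (?c - 1) g'"
    using nondegenerate_projection[OF w Suc.prems(1)] by auto
  show ?case
  proof (rule Suc.IH)
    show "nondegenerate n b (n + b - 1 + i) g'" using nd by simp
    fix K assume K: "K \<in> subsets_of_card (n + b - 1 + i) n"
    then have "finite K" using finite_subset by blast
    show "exterior_minor b g' [0..<n] \<tau> K = 0"
      by (rule exterior_minor_zero_coordinate_change[OF Suc.prems(2) g']) (use K \<open>finite K\<close> in auto)
  qed
qed

theorem exterior_minors_independent:
  assumes nd: "nondegenerate n b c g"
    and van: "\<And>K. K \<in> subsets_of_card c n \<Longrightarrow> exterior_minor b g [0..<n] \<tau> K = 0"
    and M: "M \<in> msets b n"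
  shows "\<tau> M = 0"
proof (cases "n = 0")
  case True
  then show ?thesis using van[of "{}"] M by simp
next
  case False
  \<comment> \<open>Zero columns are added, giving the ambient dimension the form n + b - 1 + i
    whatever c is.\<close>
  define g' where "g' l j k = (\<Sum>k'<c. (if k' = k then 1 else 0) * g l j k')" for l j k
  have eq: "g' l j k = g l j k" if "k < c" for l j k
    using that by (simp add: g'_def if_distrib[of "\<lambda>x. x * _"] cong: if_cong)
  have "nondegenerate n b (n + b - 1 + c) g'"
    unfolding nondegenerate_def
  proof (intro allI impI)
    fix u \<beta> assume 0: "\<forall>k<n + b - 1 + c. (\<Sum>l<n. \<Sum>j<b. u l * \<beta> j * g' l j k) = 0"
    have "(\<Sum>l<n. \<Sum>j<b. u l * \<beta> j * g l j k) = 0" if "k < c" for k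
      using 0[rule_format, of k] that eq[OF that] by simp
    then show "(\<forall>l<n. u l = 0) \<or> (\<forall>j<b. \<beta> j = 0)" using nd unfolding nondegenerate_def by blast
  qed
  then show ?thesis
  proof (rule exterior_minors_independent_above_critical[rotated])
    fix K assume K: "K \<in> subsets_of_card (n + b - 1 + c) n"
    then have "finite K" using finite_subset by blast
    show "exterior_minor b g' [0..<n] \<tau> K = 0"
      by (rule exterior_minor_zero_coordinate_change[OF van g'_def]) (use K \<open>finite K\<close> in auto)
  qed (use False M in auto)
qed

section \<open>Syzygies at a point outside X\<close>

lemma sum_sym_tensor_permute:
  assumes t: "sym_tensor b n t" and \<sigma>: "\<sigma> permutes {..<n}"
  shows "(\<Sum>js\<in>idx_lists b n. t js * F (permute_list \<sigma> js)) = (\<Sum>js\<in>idx_lists b n. t js * F js)"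
proof (rule sum.reindex_bij_witness[of _ "permute_list (inv_into UNIV \<sigma>)" "permute_list \<sigma>"])
  let ?i = "inv_into UNIV \<sigma>"
  have \<sigma>': "?i permutes {..<n}" using \<sigma> by (rule permutes_inv)
  have inv: "\<sigma> \<circ> ?i = id" "?i \<circ> \<sigma> = id" using permutes_inv_o[OF \<sigma>] by auto
  fix js assume js: "js \<in> idx_lists b n"
  then have len: "length js = n" by (simp add: idx_lists_def)
  show "permute_list ?i (permute_list \<sigma> js) = js"
    using permute_list_compose[of ?i js \<sigma>] \<sigma>' len inv by simp
  show "permute_list \<sigma> (permute_list ?i js) = js"
    using permute_list_compose[of \<sigma> js ?i] \<sigma> len inv by simp
  show 1: "permute_list \<sigma> js \<in> idx_lists b n" and "permute_list ?i js \<in> idx_lists b n"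
    using js \<sigma> \<sigma>' len by (auto simp: idx_lists_def set_permute_list)
  have "mset (permute_list \<sigma> js) = mset js" using \<sigma> len by simp
  then show "t (permute_list \<sigma> js) * F (permute_list \<sigma> js) = t js * F (permute_list \<sigma> js)"
    using t js 1 unfolding sym_tensor_def by metis
qed

text \<open>In the Leibniz term of \<pi>, permuting the positions of js by \<pi> moves the indices
  from columns to rows, and t is invariant. Row operations need the indices on the columns,
  \<open>exterior_minor\<close> has them on the rows.\<close>

lemma sum_sym_tensor_detn_index_columns:
  assumes t: "sym_tensor b n t"
  shows "(\<Sum>js\<in>idx_lists b n. t js * detn n (\<lambda>s u. F s (js ! s) u)) =
    (\<Sum>js\<in>idx_lists b n. t js * detn n (\<lambda>s u. F s (js ! u) u))"
proof -
  have "(\<Sum>js\<in>idx_lists b n. t js * detn n (\<lambda>s u. F s (js ! u) u)) =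
      (\<Sum>\<pi> | \<pi> permutes {..<n}. of_int (sign \<pi>) * (\<Sum>js\<in>idx_lists b n. t js * (\<Prod>s<n. F s (js ! \<pi> s) (\<pi> s))))"
    unfolding detn_def sum_distrib_left by (subst sum.swap) (simp add: mult_ac)
  also have "\<dots> = (\<Sum>\<pi> | \<pi> permutes {..<n}. of_int (sign \<pi>) * (\<Sum>js\<in>idx_lists b n. t js * (\<Prod>s<n. F s (js ! s) (\<pi> s))))"
  proof (rule sum.cong[OF refl], rule arg_cong2[where f = times, OF refl])
    fix \<pi> assume "\<pi> \<in> {\<pi>. \<pi> permutes {..<n}}"
    then have \<pi>: "\<pi> permutes {..<n}" by simp
    have "(\<Prod>s<n. F s (js ! \<pi> s) (\<pi> s)) = (\<Prod>s<n. F s (permute_list \<pi> js ! s) (\<pi> s))" if "js \<in> idx_lists b n" for js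
      using that \<pi> by (intro prod.cong refl) (simp add: idx_lists_def permute_list_nth)
    then show "(\<Sum>js\<in>idx_lists b n. t js * (\<Prod>s<n. F s (js ! \<pi> s) (\<pi> s))) =
        (\<Sum>js\<in>idx_lists b n. t js * (\<Prod>s<n. F s (js ! s) (\<pi> s)))"
      using sum_sym_tensor_permute[OF t \<pi>, of "\<lambda>js. \<Prod>s<n. F s (js ! s) (\<pi> s)"] by simp
  qed
  also have "\<dots> = (\<Sum>js\<in>idx_lists b n. t js * detn n (\<lambda>s u. F s (js ! s) u))"
    unfolding detn_def sum_distrib_left by (subst sum.swap) (simp add: mult_ac)
  finally show ?thesis by simp
qed

text \<open>By symmetry of t every \<sigma> in the polarization contributes the same, hence the
  factor n!.\<close>

lemma ext_coeff_eq:
  assumes t: "sym_tensor b n t"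
  shows "ext_coeff b n g R t K = fact n * (\<Sum>js\<in>idx_lists b n. t js *
    detn n (\<lambda>s u. g (sorted_list_of_set R ! s) (js ! u) (sorted_list_of_set K ! u)))"
proof -
  let ?F = "\<lambda>s j u. g (sorted_list_of_set R ! s) j (sorted_list_of_set K ! u)"
  have "ext_coeff b n g R t K =
      (\<Sum>\<sigma> | \<sigma> permutes {..<n}. \<Sum>js\<in>idx_lists b n. t js * detn n (\<lambda>s u. ?F s (js ! \<sigma> s) u))"
    unfolding ext_coeff_def sum_distrib_left by (rule sum.swap)
  also have "\<dots> = (\<Sum>\<sigma> | \<sigma> permutes {..<n}. \<Sum>js\<in>idx_lists b n. t js * detn n (\<lambda>s u. ?F s (js ! s) u))"
  proof (rule sum.cong[OF refl])
    fix \<sigma> assume "\<sigma> \<in> {\<sigma>. \<sigma> permutes {..<n}}"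
    then have \<sigma>: "\<sigma> permutes {..<n}" by simp
    have "detn n (\<lambda>s u. ?F s (js ! \<sigma> s) u) = detn n (\<lambda>s u. ?F s (permute_list \<sigma> js ! s) u)" if "js \<in> idx_lists b n" for js
      using that \<sigma> by (intro detn_cong) (simp add: idx_lists_def permute_list_nth)
    then show "(\<Sum>js\<in>idx_lists b n. t js * detn n (\<lambda>s u. ?F s (js ! \<sigma> s) u)) =
        (\<Sum>js\<in>idx_lists b n. t js * detn n (\<lambda>s u. ?F s (js ! s) u))"
      using sum_sym_tensor_permute[OF t \<sigma>, of "\<lambda>js. detn n (\<lambda>s u. ?F s (js ! s) u)"] by simp
  qed
  also have "\<dots> = fact n * (\<Sum>js\<in>idx_lists b n. t js * detn n (\<lambda>s u. ?F s (js ! s) u))"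
    by (simp add: card_permutations)
  finally show ?thesis using sum_sym_tensor_detn_index_columns[OF t, of ?F] by simp
qed

section \<open>Laplace expansion along several vectors\<close>

definition cross_sign :: "nat set \<Rightarrow> nat set \<Rightarrow> complex" where
  "cross_sign I J = (- 1) ^ card {(i, j). i \<in> I \<and> j \<in> J \<and> j < i}"

lemma cross_sign_insert:
  assumes "finite I" "finite J" "k \<notin> I" "k \<notin> J" "I \<inter> J = {}"
  shows "cross_sign (insert k I) J * pos_sign k (insert k I) = pos_sign k (insert k I \<union> J) * cross_sign I J"
proof -
  have fin: "finite {(i, j). i \<in> I \<and> j \<in> J \<and> j < i}"
    by (rule finite_subset[of _ "I \<times> J"]) (use assms in auto)
  have "{(i, j). i \<in> insert k I \<and> j \<in> J \<and> j < i} =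
      {(i, j). i \<in> I \<and> j \<in> J \<and> j < i} \<union> Pair k ` {j\<in>J. j < k}" using assms by auto
  also have "card \<dots> = card {(i, j). i \<in> I \<and> j \<in> J \<and> j < i} + card (Pair k ` {j\<in>J. j < k})"
    by (rule card_Un_disjoint) (use assms fin in auto)
  also have "card (Pair k ` {j\<in>J. j < k}) = card {j\<in>J. j < k}"
    by (rule card_image) (auto simp: inj_on_def)
  finally have 1: "cross_sign (insert k I) J = cross_sign I J * (- 1) ^ card {j\<in>J. j < k}"
    by (simp add: cross_sign_def power_add)
  have "{i\<in>insert k I \<union> J. i < k} = {i\<in>insert k I. i < k} \<union> {j\<in>J. j < k}" by auto
  also have "card \<dots> = card {i\<in>insert k I. i < k} + card {j\<in>J. j < k}"
    by (rule card_Un_disjoint) (use assms in auto)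
  finally show ?thesis unfolding 1 by (simp add: pos_sign_def power_add)
qed

text \<open>Expanding off x first gives pairs (k, I) with k outside I; they correspond to pairs
  (insert k I, k), and \<open>cross_sign_insert\<close> matches the signs.\<close>

lemma foldr_wedge_append_laplace:
  assumes "finite K"
  shows "foldr wedge (xs @ ys) (\<lambda>_. 1) K = (\<Sum>I | I \<subseteq> K \<and> card I = length xs.
    cross_sign I (K - I) * foldr wedge xs (\<lambda>_. 1) I * foldr wedge ys (\<lambda>_. 1) (K - I))"
  using assms
proof (induction xs arbitrary: K)
  case Nil
  have "{I. I \<subseteq> K \<and> card I = 0} = {{}}" using Nil by (auto dest: finite_subset)
  then show ?case by (simp add: cross_sign_def)
next
  case (Cons x xs)
  let ?W = "\<lambda>xs. foldr wedge xs (\<lambda>_. 1)"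
  let ?S = "\<lambda>K k. {I. I \<subseteq> K \<and> card I = k}"
  have finS: "finite (?S L k)" if "finite L" for L :: "nat set" and k
    by (rule finite_subset[of _ "Pow L"]) (use that in auto)
  have "?W ((x # xs) @ ys) K = (\<Sum>k\<in>K. \<Sum>I\<in>?S (K - {k}) (length xs).
      pos_sign k K * x k * (cross_sign I (K - {k} - I) * ?W xs I * ?W ys (K - {k} - I)))"
    unfolding append_Cons foldr_Cons comp_def wedge_def[of x] using Cons
    by (simp add: sum_distrib_left)
  also have "\<dots> = (\<Sum>(k, I)\<in>(SIGMA k:K. ?S (K - {k}) (length xs)).
      pos_sign k K * x k * (cross_sign I (K - {k} - I) * ?W xs I * ?W ys (K - {k} - I)))"
    using Cons.prems finS by (subst sum.Sigma) auto
  also have "\<dots> = (\<Sum>(I, k)\<in>(SIGMA I:?S K (Suc (length xs)). I).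
      cross_sign I (K - I) * (pos_sign k I * x k * ?W xs (I - {k})) * ?W ys (K - I))"
  proof (rule sum.reindex_bij_witness[of _ "\<lambda>(I, k). (k, I - {k})" "\<lambda>(k, I). (insert k I, k)"])
    fix z assume z: "z \<in> (SIGMA k:K. ?S (K - {k}) (length xs))"
    obtain k I where [simp]: "z = (k, I)" by force
    have I: "k \<in> K" "I \<subseteq> K - {k}" "card I = length xs" using z by auto
    have fin: "finite I" "finite (K - insert k I)" using I Cons.prems finite_subset by auto
    show "(case case z of (k, I) \<Rightarrow> (insert k I, k) of (I, k) \<Rightarrow> (k, I - {k})) = z" using I by auto
    show "(case z of (k, I) \<Rightarrow> (insert k I, k)) \<in> (SIGMA I:?S K (Suc (length xs)). I)"
      using I fin by (auto simp: card_insert_if)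
    have disj: "k \<notin> I" "k \<notin> K - insert k I" "I \<inter> (K - insert k I) = {}" using I by auto
    have "insert k I \<union> (K - insert k I) = K" "K - {k} - I = K - insert k I" "insert k I - {k} = I" using I by auto
    moreover from this have "cross_sign (insert k I) (K - insert k I) * pos_sign k (insert k I) = pos_sign k K * cross_sign I (K - insert k I)"
      using cross_sign_insert[OF fin disj] by simp
    ultimately show "(case case z of (k, I) \<Rightarrow> (insert k I, k) of (I, k) \<Rightarrow>
          cross_sign I (K - I) * (pos_sign k I * x k * ?W xs (I - {k})) * ?W ys (K - I)) =
        (case z of (k, I) \<Rightarrow> pos_sign k K * x k * (cross_sign I (K - {k} - I) * ?W xs I * ?W ys (K - {k} - I)))"
      by (simp add: mult_ac)
  next
    fix z assume z: "z \<in> (SIGMA I:?S K (Suc (length xs)). I)"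
    obtain I k where [simp]: "z = (I, k)" by force
    have I: "k \<in> I" "I \<subseteq> K" "card I = Suc (length xs)" using z by auto
    show "(case case z of (I, k) \<Rightarrow> (k, I - {k}) of (k, I) \<Rightarrow> (insert k I, k)) = z" using I by auto
    show "(case z of (I, k) \<Rightarrow> (k, I - {k})) \<in> (SIGMA k:K. ?S (K - {k}) (length xs))" using I by auto
  qed
  also have "\<dots> = (\<Sum>I\<in>?S K (Suc (length xs)). \<Sum>k\<in>I.
      cross_sign I (K - I) * (pos_sign k I * x k * ?W xs (I - {k})) * ?W ys (K - I))"
    using Cons.prems finS finite_subset by (subst sum.Sigma) auto
  also have "\<dots> = (\<Sum>I\<in>?S K (Suc (length xs)). cross_sign I (K - I) * ?W (x # xs) I * ?W ys (K - I))"
    by (simp add: wedge_def[of x] sum_distrib_left sum_distrib_right)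
  finally show ?case by simp
qed

text \<open>Entry in row i and column s of the square matrix whose first b columns are M(p) and
  whose other columns are vectors in A read off from g.\<close>

definition syz_columns :: "nat \<Rightarrow> nat \<Rightarrow> (nat \<Rightarrow> nat \<Rightarrow> nat \<Rightarrow> complex) \<Rightarrow> (nat \<Rightarrow> complex) \<Rightarrow> nat list \<Rightarrow> nat set
    \<Rightarrow> nat \<Rightarrow> nat \<Rightarrow> complex" where
  "syz_columns b c g p js K s i =
    (if s < b then matM c g p i s else g i (js ! (s - b)) (sorted_list_of_set K ! (s - b)))"

text \<open>The comultiplication is Laplace expansion along the first b columns, because
  \<open>shuffle_sign\<close> is \<open>cross_sign\<close> of I and its complement.\<close>

lemma syz_comp_eq_sum_detn:
  assumes "b \<le> a" and t: "sym_tensor b (a - b) t"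
  shows "syz_comp a b c g t K p = fact (a - b) *
    (\<Sum>js\<in>idx_lists b (a - b). t js * detn a (\<lambda>i s. syz_columns b c g p js K s i))"
proof -
  let ?n = "a - b"
  let ?N = "\<lambda>I js. detn ?n (\<lambda>s u. g (sorted_list_of_set ({..<a} - I) ! s) (js ! u) (sorted_list_of_set K ! u))"
  have exp: "(\<Sum>I | I \<subseteq> {..<a} \<and> card I = b. shuffle_sign a I * minor b c g I p * ?N I js) =
      detn a (\<lambda>i s. syz_columns b c g p js K s i)" for js
  proof -
    define xs where "xs = map (\<lambda>s i. matM c g p i s) [0..<b]"
    define ys where "ys = map (\<lambda>u i. g i (js ! u) (sorted_list_of_set K ! u)) [0..<?n]"
    have "detn a (\<lambda>i s. syz_columns b c g p js K s i) = detn a (\<lambda>s i. syz_columns b c g p js K s i)"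
      by (rule detn_transpose)
    also have "\<dots> = detn (length (xs @ ys)) (\<lambda>s u. ((xs @ ys) ! s) (sorted_list_of_set {..<a} ! u))"
    proof -
      have "length (xs @ ys) = a" using assms by (simp add: xs_def ys_def)
      moreover have "detn a (\<lambda>s i. syz_columns b c g p js K s i) = detn a (\<lambda>s u. ((xs @ ys) ! s) (sorted_list_of_set {..<a} ! u))"
        by (rule detn_cong) (auto simp: syz_columns_def xs_def ys_def nth_append lessThan_atLeast0)
      ultimately show ?thesis by simp
    qed
    also have "\<dots> = foldr wedge (xs @ ys) (\<lambda>_. 1) {..<a}"
      by (rule foldr_wedge_eq_detn[symmetric]) (use assms in \<open>auto simp: xs_def ys_def\<close>)
    also have "\<dots> = (\<Sum>I | I \<subseteq> {..<a} \<and> card I = length xs. cross_sign I ({..<a} - I) *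
        foldr wedge xs (\<lambda>_. 1) I * foldr wedge ys (\<lambda>_. 1) ({..<a} - I))"
      by (rule foldr_wedge_append_laplace) simp
    also have "\<dots> = (\<Sum>I | I \<subseteq> {..<a} \<and> card I = b. shuffle_sign a I * minor b c g I p * ?N I js)"
    proof (rule sum.cong)
      fix I assume "I \<in> {I. I \<subseteq> {..<a} \<and> card I = b}"
      then have I: "I \<subseteq> {..<a}" "card I = b" "finite I" using finite_subset by auto
      have "foldr wedge xs (\<lambda>_. 1) I = detn b (\<lambda>s u. (xs ! s) (sorted_list_of_set I ! u))"
        using foldr_wedge_eq_detn[OF I(3), of xs] I by (simp add: xs_def)
      also have "\<dots> = detn b (\<lambda>s u. matM c g p (sorted_list_of_set I ! u) s)"
        by (rule detn_cong) (simp add: xs_def)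
      also have "\<dots> = minor b c g I p" unfolding minor_def by (rule detn_transpose)
      finally have 1: "foldr wedge xs (\<lambda>_. 1) I = minor b c g I p" .
      have card: "card ({..<a} - I) = ?n" using I by (simp add: card_Diff_subset)
      then have "foldr wedge ys (\<lambda>_. 1) ({..<a} - I) = detn ?n (\<lambda>s u. (ys ! s) (sorted_list_of_set ({..<a} - I) ! u))"
        using foldr_wedge_eq_detn[of "{..<a} - I" ys] by (simp add: ys_def)
      also have "\<dots> = detn ?n (\<lambda>s u. g (sorted_list_of_set ({..<a} - I) ! u) (js ! s) (sorted_list_of_set K ! s))"
        by (rule detn_cong) (simp add: ys_def)
      also have "\<dots> = ?N I js" by (rule detn_transpose)
      finally show "cross_sign I ({..<a} - I) * foldr wedge xs (\<lambda>_. 1) I * foldr wedge ys (\<lambda>_. 1) ({..<a} - I) =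
        shuffle_sign a I * minor b c g I p * ?N I js"
        using 1 by (simp add: cross_sign_def shuffle_sign_def)
    qed (simp add: xs_def)
    finally show ?thesis by simp
  qed
  have "syz_comp a b c g t K p = (\<Sum>I | I \<subseteq> {..<a} \<and> card I = b. \<Sum>js\<in>idx_lists b ?n.
      fact ?n * (t js * (shuffle_sign a I * minor b c g I p * ?N I js)))"
    unfolding syz_comp_def ext_coeff_eq[OF t] sum_distrib_left by (simp add: mult_ac)
  also have "\<dots> = (\<Sum>js\<in>idx_lists b ?n. fact ?n * (t js *
      (\<Sum>I | I \<subseteq> {..<a} \<and> card I = b. shuffle_sign a I * minor b c g I p * ?N I js)))"
    by (subst sum.swap) (simp only: sum_distrib_left)
  finally show ?thesis unfolding exp by (simp add: sum_distrib_left)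
qed

lemma detn_nonzero_transpose_injective:
  assumes "detn b M \<noteq> 0" "\<And>j. j < b \<Longrightarrow> (\<Sum>s<b. M s j * x s) = 0"
  shows "\<forall>s<b. x s = 0"
proof (rule ccontr)
  assume nz: "\<not> (\<forall>s<b. x s = 0)"
  let ?A = "mat b b (\<lambda>(j, s). M s j)"
  have "?A *\<^sub>v vec b x = 0\<^sub>v b"
    using assms(2) by (intro eq_vecI) (auto simp: scalar_prod_def lessThan_atLeast0)
  moreover have "vec b x \<noteq> 0\<^sub>v b" using nz by (metis index_vec index_zero_vec(1))
  ultimately have "det ?A = 0" using det_0_iff_vec_prod_zero[of ?A b] vec_carrier[of b x] by (metis mat_carrier)
  then show False using assms(1) detn_transpose[of b M] by (simp add: detn_eq_det)
qed

text \<open>At a point where the minor of the rows \<open>I\<^sub>0\<close> does not vanish, the vectors \<open>q l\<close> form a basis of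
  the kernel of the transposed matrix. Row operations turn the component of the syzygy into the
  exterior minor of the rows \<open>q l\<close>, up to the factor given by that minor.\<close>

lemma nonzero_minor_kernel_rows:
  assumes "b \<le> a" "I\<^sub>0 \<subseteq> {..<a}" "card I\<^sub>0 = b" "minor b c g I\<^sub>0 p \<noteq> 0"
  shows "\<exists>(y :: nat \<Rightarrow> nat) (q :: nat \<Rightarrow> nat \<Rightarrow> complex) d. (\<forall>l<a - b. y l < a) \<and>
    (\<forall>l<a - b. \<forall>l'<a - b. q l (y l') = (if l = l' then 1 else 0)) \<and>
    (\<forall>js K. d * detn a (\<lambda>i s. syz_columns b c g p js K s i) =
       minor b c g I\<^sub>0 p * detn (a - b) (\<lambda>l u. \<Sum>i<a. q l i * g i (js ! u) (sorted_list_of_set K ! u)))"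
proof -
  let ?n = "a - b"
  define x where "x s = sorted_list_of_set I\<^sub>0 ! s" for s
  define y where "y l = sorted_list_of_set ({..<a} - I\<^sub>0) ! l" for l
  have fin: "finite I\<^sub>0" using assms finite_subset by blast
  have x: "x s < a" "x s \<in> I\<^sub>0" if "s < b" for s
    using that assms fin nth_mem[of s "sorted_list_of_set I\<^sub>0"] by (auto simp: x_def)
  have len: "length (sorted_list_of_set ({..<a} - I\<^sub>0)) = ?n" using assms fin by (simp add: card_Diff_subset)
  have y: "y l < a" "y l \<notin> I\<^sub>0" if "l < ?n" for l
    using that len nth_mem[of l "sorted_list_of_set ({..<a} - I\<^sub>0)"] by (auto simp: y_def)
  have yinj: "y l = y l' \<longleftrightarrow> l = l'" if "l < ?n" "l' < ?n" for l l'
    using that len nth_eq_iff_index_eq[of "sorted_list_of_set ({..<a} - I\<^sub>0)" l l'] by (simp add: y_def)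
  let ?m = "matM c g p"
  have det0: "detn b (\<lambda>s j. ?m (x s) j) = minor b c g I\<^sub>0 p" by (simp add: minor_def x_def)
  have "\<exists>X. \<forall>j\<in>{..<b}. (\<Sum>s\<in>{..<b}. ?m (x s) j * X s) = ?m (y l) j" for l
  proof (rule injective_square_system_solvable)
    fix X assume "\<And>j. j \<in> {..<b} \<Longrightarrow> (\<Sum>s<b. ?m (x s) j * X s) = 0"
    then show "\<forall>s\<in>{..<b}. X s = 0"
      using detn_nonzero_transpose_injective[of b "\<lambda>s j. ?m (x s) j" X] det0 assms(4) by auto
  qed auto
  then obtain X where X: "\<And>l j. j < b \<Longrightarrow> (\<Sum>s<b. ?m (x s) j * X l s) = ?m (y l) j" by (metis lessThan_iff)
  \<comment> \<open>X writes row y l of M(p) as a combination of the rows x s; q l is the difference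
    of the two, so it annihilates M(p).\<close>
  define q where "q l i = (if i = y l then 1 else 0) - (\<Sum>s<b. X l s * (if i = x s then 1 else 0))" for l i
  have q: "(\<Sum>i<a. q l i * z i) = z (y l) - (\<Sum>s<b. X l s * z (x s))" if "l < ?n" for l and z :: "nat \<Rightarrow> complex"
  proof -
    have "(\<Sum>i<a. q l i * z i) = (\<Sum>i<a. (if i = y l then z i else 0)) - (\<Sum>i<a. \<Sum>s<b. if i = x s then X l s * z i else 0)"
      unfolding sum_subtractf[symmetric] q_def left_diff_distrib sum_distrib_right
      by (intro sum.cong refl arg_cong2[where f = minus]) auto
    also have "(\<Sum>i<a. \<Sum>s<b. if i = x s then X l s * z i else 0) = (\<Sum>s<b. X l s * z (x s))"
      by (subst sum.swap) (use x in \<open>auto intro!: sum.cong\<close>)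
    also have "(\<Sum>i<a. (if i = y l then z i else 0)) = z (y l)" using y[OF that] by simp
    finally show ?thesis .
  qed
  \<comment> \<open>The top rows of Q select the rows x s, the bottom rows are the q l. This makes
    the product block upper triangular, with the chosen minor as determinant of the first
    block.\<close>
  define Q where "Q = mat a a (\<lambda>(r, i). if r < b then (if i = x r then 1 else 0) else q (r - b) i)"
  have main: "det Q * detn a (\<lambda>i s. syz_columns b c g p js K s i) =
       minor b c g I\<^sub>0 p * detn ?n (\<lambda>l u. \<Sum>i<a. q l i * g i (js ! u) (sorted_list_of_set K ! u))" for js K
  proof -
    let ?C = "mat a a (\<lambda>(i, s). syz_columns b c g p js K s i)"
    let ?h = "\<lambda>l u. \<Sum>i<a. q l i * g i (js ! u) (sorted_list_of_set K ! u)"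
    let ?A1 = "mat b b (\<lambda>(s, j). ?m (x s) j)" and ?A4 = "mat ?n ?n (\<lambda>(l, u). ?h l u)"
    let ?A2 = "mat b ?n (\<lambda>(r, u). g (x r) (js ! u) (sorted_list_of_set K ! u))"
    have "Q * ?C = four_block_mat ?A1 ?A2 (0\<^sub>m ?n b) ?A4"
    proof (rule eq_matI)
      fix r s assume "r < dim_row (four_block_mat ?A1 ?A2 (0\<^sub>m ?n b) ?A4)"
        "s < dim_col (four_block_mat ?A1 ?A2 (0\<^sub>m ?n b) ?A4)"
      then have rs: "r < a" "s < a" using assms(1) by auto
      have "(Q * ?C) $$ (r, s) = (\<Sum>i<a. (if r < b then (if i = x r then 1 else 0) else q (r - b) i) * syz_columns b c g p js K s i)"
        using rs by (simp add: Q_def scalar_prod_def lessThan_atLeast0)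
      also have "\<dots> = (if r < b then syz_columns b c g p js K s (x r) else (\<Sum>i<a. q (r - b) i * syz_columns b c g p js K s i))"
        using x[of r] by (auto simp: if_distrib[of "\<lambda>v. v * _"] cong: if_cong)
      also have "\<dots> = four_block_mat ?A1 ?A2 (0\<^sub>m ?n b) ?A4 $$ (r, s)"
      proof (cases "r < b \<or> s \<ge> b")
        case True
        then show ?thesis using rs assms(1) by (auto simp: syz_columns_def)
      next
        case False
        then have "r - b < ?n" using rs by auto
        from q[OF this, of "\<lambda>i. ?m i s"] have "(\<Sum>i<a. q (r - b) i * ?m i s) = 0"
          using X[of s "r - b"] False by (simp add: mult.commute)
        then show ?thesis using rs assms(1) False by (auto simp: syz_columns_def)
      qed
      finally show "(Q * ?C) $$ (r, s) = four_block_mat ?A1 ?A2 (0\<^sub>m ?n b) ?A4 $$ (r, s)" .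
    qed (use assms(1) in \<open>auto simp: Q_def\<close>)
    then have "det Q * det ?C = det ?A1 * det ?A4"
      using det_mult[of Q a ?C] det_four_block_mat_lower_left_zero[of ?A1 b ?A2 ?n "0\<^sub>m ?n b" ?A4]
      by (simp add: Q_def)
    then show ?thesis using det0 by (simp add: detn_eq_det)
  qed
  \<comment> \<open>The coordinates y l' of the q l form an identity matrix; this records their
    independence.\<close>
  have qy: "q l (y l') = (if l = l' then 1 else 0)" if l: "l < ?n" "l' < ?n" for l l'
  proof -
    have "y l' \<noteq> x s" if "s < b" for s using x(2)[OF that] y(2)[OF l(2)] by auto
    then have "(\<Sum>s<b. X l s * (if y l' = x s then 1 else 0)) = 0" by (intro sum.neutral) auto
    then show ?thesis using yinj[OF l] by (auto simp: q_def)
  qed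
  show ?thesis
    by (intro exI[of _ y] exI[of _ q] exI[of _ "det Q"] conjI allI impI) (fact y qy main)+
qed

text \<open>The combination \<alpha> of the q l with coefficients u has u l as its coordinate y l,
  so it is nonzero with u, and injectivity at \<alpha> forces \<beta> = 0.\<close>

lemma one_generic_nondegenerate_subspace:
  assumes "one_generic a b c g"
    and y: "\<And>l. l < n \<Longrightarrow> y l < a"
    and q: "\<And>l l'. l < n \<Longrightarrow> l' < n \<Longrightarrow> q l (y l') = (if l = l' then 1 else 0)"
  shows "nondegenerate n b c (\<lambda>l j k. \<Sum>i<a. q l i * g i j k)"
  unfolding nondegenerate_def
proof (intro allI impI)
  fix u \<beta> assume 0: "\<forall>k<c. (\<Sum>l<n. \<Sum>j<b. u l * \<beta> j * (\<Sum>i<a. q l i * g i j k)) = 0"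
  show "(\<forall>l<n. u l = 0) \<or> (\<forall>j<b. \<beta> j = 0)"
  proof (rule ccontr)
    assume "\<not> ((\<forall>l<n. u l = 0) \<or> (\<forall>j<b. \<beta> j = 0))"
    then obtain l0 j0 where l0: "l0 < n" "u l0 \<noteq> 0" and j0: "j0 < b" "\<beta> j0 \<noteq> 0" by auto
    define \<alpha> where "\<alpha> i = (if i < a then \<Sum>l<n. u l * q l i else 0)" for i
    define \<beta>' where "\<beta>' j = (if j < b then \<beta> j else 0)" for j
    have "\<alpha> (y l0) = (\<Sum>l<n. if l = l0 then u l else 0)"
      unfolding \<alpha>_def if_P[OF y[OF l0(1)]] by (intro sum.cong refl) (simp add: q[OF _ l0(1)])
    also have "\<dots> = u l0" using l0 by simp
    finally have "\<alpha> \<noteq> (\<lambda>_. 0)" using l0 by auto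
    moreover have "\<alpha> \<in> vecs a" by (simp add: vecs_def \<alpha>_def)
    ultimately have \<alpha>: "\<alpha> \<in> vecs a" "\<alpha> \<noteq> (\<lambda>_. 0)" by auto
    have \<beta>': "\<beta>' \<in> vecs b" "(\<lambda>_. 0) \<in> vecs b" by (auto simp: vecs_def \<beta>'_def)
    have "(\<Sum>i<a. \<Sum>j<b. \<alpha> i * \<beta>' j * g i j k) = 0" if "k < c" for k
    proof -
      have "(\<Sum>i<a. \<Sum>j<b. \<alpha> i * \<beta>' j * g i j k) = (\<Sum>i<a. \<Sum>j<b. \<Sum>l<n. u l * \<beta> j * (q l i * g i j k))"
        by (intro sum.cong refl) (simp add: \<alpha>_def \<beta>'_def sum_distrib_right sum_distrib_left mult_ac)
      also have "\<dots> = (\<Sum>i<a. \<Sum>l<n. \<Sum>j<b. u l * \<beta> j * (q l i * g i j k))"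
        by (intro sum.cong refl sum.swap)
      also have "\<dots> = (\<Sum>l<n. \<Sum>i<a. \<Sum>j<b. u l * \<beta> j * (q l i * g i j k))"
        by (rule sum.swap)
      also have "\<dots> = (\<Sum>l<n. \<Sum>j<b. \<Sum>i<a. u l * \<beta> j * (q l i * g i j k))"
        by (intro sum.cong refl sum.swap)
      also have "\<dots> = 0" using 0[rule_format, OF that] by (simp add: sum_distrib_left)
      finally show ?thesis .
    qed
    then have "gam_left a b c g \<alpha> \<beta>' = gam_left a b c g \<alpha> (\<lambda>_. 0)"
      by (auto simp: gam_left_def fun_eq_iff)
    moreover have "inj_on (gam_left a b c g \<alpha>) (vecs b)"
      using assms(1) \<alpha> unfolding one_generic_def by blast
    ultimately have "\<beta>' = (\<lambda>_. 0)" using \<beta>' by (auto dest: inj_onD)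
    then show False using j0 by (auto simp: \<beta>'_def fun_eq_iff split: if_splits)
  qed
qed

theorem mainTheorem3:
  fixes a b c :: nat and g :: "nat \<Rightarrow> nat \<Rightarrow> nat \<Rightarrow> complex" and t :: "nat list \<Rightarrow> complex"
  assumes "b \<le> a"
    and "one_generic a b c g"
    and "sym_tensor b (a - b) t"
    and "\<exists>js\<in>idx_lists b (a - b). t js \<noteq> 0"
  shows "supp_Syz a b c g t = supp_X a b c g"
proof
  show "supp_X a b c g \<subseteq> supp_Syz a b c g t"
    by (auto simp: supp_X_def supp_Syz_def syz_comp_def)
next
  let ?n = "a - b"
  show "supp_Syz a b c g t \<subseteq> supp_X a b c g"
  proof
    fix p assume p: "p \<in> supp_Syz a b c g t"
    show "p \<in> supp_X a b c g"
    proof (rule ccontr)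
      assume "p \<notin> supp_X a b c g"
      then obtain I where I: "I \<subseteq> {..<a}" "card I = b" "minor b c g I p \<noteq> 0"
        using p by (auto simp: supp_X_def supp_Syz_def)
      from nonzero_minor_kernel_rows[OF assms(1) I] obtain y q d where y: "\<forall>l<?n. y l < a"
        and q: "\<forall>l<?n. \<forall>l'<?n. q l (y l') = (if l = l' then 1 else 0)"
        and d: "\<forall>js K. d * detn a (\<lambda>i s. syz_columns b c g p js K s i) =
          minor b c g I p * detn ?n (\<lambda>l u. \<Sum>i<a. q l i * g i (js ! u) (sorted_list_of_set K ! u))"
        by (elim exE conjE) (rule that)
      let ?h = "\<lambda>l j k. \<Sum>i<a. q l i * g i j k"
      \<comment> \<open>Any list representing N will do, by symmetry of t.\<close>
      define \<tau> where "\<tau> N = t (SOME js. js \<in> idx_lists b ?n \<and> mset js = N)" for N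
      have \<tau>: "\<tau> (mset js) = t js" if js: "js \<in> idx_lists b ?n" for js
      proof -
        have "\<exists>ks. ks \<in> idx_lists b ?n \<and> mset ks = mset js" using js by blast
        from someI_ex[OF this] show ?thesis
          using assms(3) js unfolding sym_tensor_def \<tau>_def by blast
      qed
      have van: "exterior_minor b ?h [0..<?n] \<tau> K = 0" if K: "K \<in> subsets_of_card c ?n" for K
      proof -
        have "finite K" using K finite_subset by blast
        have "(\<Sum>js\<in>idx_lists b ?n. t js * detn a (\<lambda>i s. syz_columns b c g p js K s i)) = 0"
          using p K syz_comp_eq_sum_detn[OF assms(1,3), of c g K p] by (simp add: supp_Syz_def)
        then have "(\<Sum>js\<in>idx_lists b ?n. t js * (d * detn a (\<lambda>i s. syz_columns b c g p js K s i))) = 0"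
          by (simp add: mult.left_commute[of _ d] sum_distrib_left[symmetric])
        then have "minor b c g I p * (\<Sum>js\<in>idx_lists b ?n. t js * detn ?n (\<lambda>l u. ?h l (js ! u) (sorted_list_of_set K ! u))) = 0"
          unfolding d[rule_format] by (simp add: mult.left_commute[of _ "minor b c g I p"] sum_distrib_left)
        \<comment> \<open>The row operations are done, and the indices go back from columns to
          rows.\<close>
        then have "(\<Sum>js\<in>idx_lists b ?n. t js * detn ?n (\<lambda>l u. ?h l (js ! l) (sorted_list_of_set K ! u))) = 0"
          using I(3) sum_sym_tensor_detn_index_columns[OF assms(3), of "\<lambda>l j u. ?h l j (sorted_list_of_set K ! u)"] by simp
        then show ?thesis
          using exterior_minor_eq_sum_detn[OF \<open>finite K\<close>, of ?n b ?h \<tau>] K \<tau> by simp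
      qed
      have "\<tau> (mset js) = 0" if "js \<in> idx_lists b ?n" for js
        by (rule exterior_minors_independent[OF one_generic_nondegenerate_subspace[OF assms(2) y[rule_format] q[rule_format]] van])
          (use that in \<open>auto simp: idx_lists_def multisets_of_size_def\<close>)
      then show False using assms(4) \<tau> by auto
    qed
  qed
qed

end
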